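(* Let $A\in\mathbb{C}^{n\times n}$ have all eigenvalues in the open unit disc, let $B\in\mathbb{C}^{n\times m}$ have full column rank, let $(A,B)$ be reachable, and put $G(z)=(zI-A)^{-1}B$. Assume feasibility: there is $H\in\mathbb{C}^{m\times n}$ with $I-AA^*=BH+H^*B^*$. Let $\Psi\in\mathcal{S}_+^{m\times m}(\mathbb{T})$ and consider $J_\Psi:\mathcal{L}^H_\Gamma\subset\operatorname{Range}\Gamma\to\mathbb{R}$, $$J_\Psi(\Lambda)=\operatorname{tr}\int (I+G^*\Lambda G)^{-1}\Psi+\operatorname{tr}\Lambda .$$ Then: 1. $J_\Psi\in C^\infty(\mathcal{L}^H_\Gamma)$. 2. $J_\Psi$ is strictly convex on $\mathcal{L}^H_\Gamma$.
   Context: $\mathbb{T}$ is the complex unit circle; $M^*$ is the conjugate transpose of a matrix $M$, and on $\mathbb{T}$, $G^*(e^{j\vartheta})=(G(e^{j\vartheta}))^*$. All integrals are over $\mathbb{T}$ with respect to the normalized Lebesgue measure $d\vartheta/2\pi$. $\mathcal{H}(k)$ is the real vector space of $k\times k$ Hermitian matrices. $\mathcal{S}_+^{m\times m}(\mathbb{T})$ is the set of (measurable) functions $\Phi:\mathbb{T}\to\mathbb{C}^{m\times m}$ with Hermitian positive definite values that are bounded and coercive (i.e. $aI\le\Phi\le bI$ on $\mathbb{T}$ for some constants $0<a\le b$). $\mathcal{C}(\mathbb{T};\mathcal{H}(m))$ is the space of continuous $\mathcal{H}(m)$-valued functions on $\mathbb{T}$, and $\Gamma:\mathcal{C}(\mathbb{T};\mathcal{H}(m))\to\mathcal{H}(n)$,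 $\Gamma(\Phi)=\int G\Phi G^*$. $\operatorname{Range}\Gamma$ is regarded as a (finite-dimensional) real vector space. $\mathcal{L}^H_\Gamma:=\{\Lambda\in\operatorname{Range}\Gamma:\ I+G^*(e^{j\vartheta})\Lambda G(e^{j\vartheta})>0\ \ \forall e^{j\vartheta}\in\mathbb{T}\}$, an open convex subset of $\operatorname{Range}\Gamma$; smoothness is understood in the finite-dimensional real vector space $\operatorname{Range}\Gamma$. *)

theory Defs
  imports "HOL-Analysis.Analysis"
begin

section \<open>Complex matrices\<close>

definition ctransp :: "complex^'n^'m \<Rightarrow> complex^'m^'n" where
  "ctransp M = (\<chi> i j. cnj (M $ j $ i))"

definition hermitian :: "complex^'n^'n \<Rightarrow> bool" where
  "hermitian M \<longleftrightarrow> ctransp M = M"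

text \<open>The inner product of \<^typ>\<open>complex^'n\<close> is the real one, so \<^term>\<open>x \<bullet> (M *v x)\<close> is the
  real part of the form $x^* M x$, which is real when \<^term>\<open>M\<close> is Hermitian
  (see \<open>hermitian_form_real\<close> below).\<close>

definition pos_def :: "complex^'n^'n \<Rightarrow> bool" where
  "pos_def M \<longleftrightarrow> hermitian M \<and> (\<forall>x. x \<noteq> 0 \<longrightarrow> x \<bullet> (M *v x) > 0)"

definition pos_semidef :: "complex^'n^'n \<Rightarrow> bool" where
  "pos_semidef M \<longleftrightarrow> hermitian M \<and> (\<forall>x. x \<bullet> (M *v x) \<ge> 0)"

definition loewner_le :: "complex^'n^'n \<Rightarrow> complex^'n^'n \<Rightarrow> bool" where
  "loewner_le M N \<longleftrightarrow> pos_semidef (N - M)"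

definition eigenvalue :: "complex^'n^'n \<Rightarrow> complex \<Rightarrow> bool" where
  "eigenvalue M l \<longleftrightarrow> (\<exists>x. x \<noteq> 0 \<and> M *v x = l *s x)"

lemma inner_complex_vec:
  fixes x y :: "complex^'n"
  shows "x \<bullet> y = Re (\<Sum>i\<in>UNIV. cnj (x $ i) * y $ i)"
  by (simp add: inner_vec_def inner_complex_def)

lemma ctransp_ctransp [simp]: "ctransp (ctransp M) = M"
  by (simp add: ctransp_def vec_eq_iff)

lemma ctransp_mult: "ctransp (M ** N) = ctransp N ** ctransp M"
  by (simp add: ctransp_def matrix_matrix_mult_def vec_eq_iff mult.commute)

lemma ctransp_mat_1 [simp]: "ctransp (mat 1) = mat 1"
  by (simp add: ctransp_def mat_def vec_eq_iff)

lemma hermitian_form_real: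
  assumes "hermitian M"
  shows "Im (\<Sum>i\<in>UNIV. cnj (x $ i) * (M *v x) $ i) = 0"
proof -
  have M: "cnj (M $ i $ j) = M $ j $ i" for i j
    using assms unfolding hermitian_def ctransp_def vec_eq_iff by auto
  let ?q = "\<Sum>i\<in>UNIV. \<Sum>j\<in>UNIV. cnj (x $ i) * (M $ i $ j * x $ j)"
  have "cnj (cnj (x $ i) * (M $ i $ j * x $ j)) = cnj (x $ j) * (M $ j $ i * x $ i)" for i j
    by (simp only: complex_cnj_mult complex_cnj_cnj M mult_ac)
  then have "cnj ?q = (\<Sum>i\<in>UNIV. \<Sum>j\<in>UNIV. cnj (x $ j) * (M $ j $ i * x $ i))"
    by (simp only: cnj_sum)
  also have "\<dots> = ?q"
    by (rule sum.swap)
  finally have "Im ?q = 0"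
    using Reals_cnj_iff complex_is_Real_iff by blast
  then show ?thesis
    by (simp add: matrix_vector_mult_def sum_distrib_left)
qed


section \<open>Smoothness and strict convexity\<close>

text \<open>Here \<^term>\<open>V\<close> is a real linear subspace of the ambient space and \<^term>\<open>U\<close> is open in
  \<^term>\<open>V\<close>, so derivatives at points of \<^term>\<open>U\<close> are determined on \<^term>\<open>V\<close>, and only their
  values there are used.\<close>

fun Ck_on :: "nat \<Rightarrow> 'a::euclidean_space set \<Rightarrow> 'a set \<Rightarrow> ('a \<Rightarrow> real) \<Rightarrow> bool" where
  "Ck_on 0 V U f \<longleftrightarrow> continuous_on U f"
| "Ck_on (Suc k) V U f \<longleftrightarrow>
     (\<exists>f'. (\<forall>x\<in>U. (f has_derivative f' x) (at x within U)) \<and>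
           (\<forall>v\<in>V. Ck_on k V U (\<lambda>x. f' x v)))"

definition smooth_in :: "'a::euclidean_space set \<Rightarrow> 'a set \<Rightarrow> ('a \<Rightarrow> real) \<Rightarrow> bool" where
  "smooth_in V U f \<longleftrightarrow> subspace V \<and> openin (top_of_set V) U \<and> (\<forall>k. Ck_on k V U f)"

definition strictly_convex_on :: "'a::real_vector set \<Rightarrow> ('a \<Rightarrow> real) \<Rightarrow> bool" where
  "strictly_convex_on S f \<longleftrightarrow> convex S \<and>
     (\<forall>x\<in>S. \<forall>y\<in>S. \<forall>u>0. \<forall>v>0. x \<noteq> y \<longrightarrow> u + v = 1 \<longrightarrow>
        f (u *\<^sub>R x + v *\<^sub>R y) < u * f x + v * f y)"


section \<open>Functions on the unit circle\<close>

text \<open>Functions on the circle are represented by functions on \<^typ>\<open>complex\<close> whose values off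
  \<^term>\<open>unit_circle\<close> are never used.\<close>

abbreviation unit_circle :: "complex set" where
  "unit_circle \<equiv> sphere 0 1"

definition circle_integral :: "(complex \<Rightarrow> 'a) \<Rightarrow> 'a::{banach, second_countable_topology}" where
  "circle_integral F =
     (1 / (2 * pi)) *\<^sub>R set_lebesgue_integral lebesgue {-pi..pi} (\<lambda>t. F (cis t))"

definition spectral_densities :: "(complex \<Rightarrow> complex^'m^'m) set" where
  "spectral_densities = {\<Phi>.
     (\<lambda>t. \<Phi> (cis t)) \<in> borel_measurable lebesgue \<and>
     (\<forall>z\<in>unit_circle. pos_def (\<Phi> z)) \<and>
     (\<exists>a b. 0 < a \<and> a \<le> b \<and>
        (\<forall>z\<in>unit_circle. loewner_le (a *\<^sub>R mat 1) (\<Phi> z) \<and> loewner_le (\<Phi> z) (b *\<^sub>R mat 1)))}"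

definition cont_hermitian :: "(complex \<Rightarrow> complex^'m^'m) set" where
  "cont_hermitian = {\<Phi>. continuous_on unit_circle \<Phi> \<and> (\<forall>z\<in>unit_circle. hermitian (\<Phi> z))}"


section \<open>The filter bank and the dual functional\<close>

primrec lti_state ::
  "complex^'n^'n \<Rightarrow> complex^'m^'n \<Rightarrow> (nat \<Rightarrow> complex^'m) \<Rightarrow> nat \<Rightarrow> complex^'n" where
  "lti_state A B u 0 = 0"
| "lti_state A B u (Suc k) = A *v lti_state A B u k + B *v u k"

definition reachable :: "complex^'n^'n \<Rightarrow> complex^'m^'n \<Rightarrow> bool" where
  "reachable A B \<longleftrightarrow> (\<forall>x. \<exists>u k. lti_state A B u k = x)"

definition transfer :: "complex^'n^'n \<Rightarrow> complex^'m^'n \<Rightarrow> complex \<Rightarrow> complex^'m^'n" where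
  "transfer A B z = matrix_inv (mat z - A) ** B"

definition Gamma ::
  "complex^'n^'n \<Rightarrow> complex^'m^'n \<Rightarrow> (complex \<Rightarrow> complex^'m^'m) \<Rightarrow> complex^'n^'n" where
  "Gamma A B \<Phi> =
     circle_integral (\<lambda>z. transfer A B z ** \<Phi> z ** ctransp (transfer A B z))"

definition range_Gamma :: "complex^'n^'n \<Rightarrow> complex^'m^'n \<Rightarrow> (complex^'n^'n) set" where
  "range_Gamma A B = Gamma A B ` cont_hermitian"

definition Q_mat ::
  "complex^'n^'n \<Rightarrow> complex^'m^'n \<Rightarrow> complex^'n^'n \<Rightarrow> complex \<Rightarrow> complex^'m^'m" where
  "Q_mat A B L z = mat 1 + ctransp (transfer A B z) ** L ** transfer A B z"

definition L_Gamma :: "complex^'n^'n \<Rightarrow> complex^'m^'n \<Rightarrow> (complex^'n^'n) set" where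
  "L_Gamma A B = {L \<in> range_Gamma A B. \<forall>z\<in>unit_circle. pos_def (Q_mat A B L z)}"

definition J_complex ::
  "complex^'n^'n \<Rightarrow> complex^'m^'n \<Rightarrow> (complex \<Rightarrow> complex^'m^'m) \<Rightarrow> complex^'n^'n \<Rightarrow> complex" where
  "J_complex A B \<Psi> L =
     trace (circle_integral (\<lambda>z. matrix_inv (Q_mat A B L z) ** \<Psi> z)) + trace L"

text \<open>The real part only changes the type: \<^term>\<open>J_complex A B \<Psi> L\<close> is real for
  \<^term>\<open>L \<in> L_Gamma A B\<close>, by \<open>J_complex_real\<close> below.\<close>

definition J ::
  "complex^'n^'n \<Rightarrow> complex^'m^'n \<Rightarrow> (complex \<Rightarrow> complex^'m^'m) \<Rightarrow> complex^'n^'n \<Rightarrow> real" where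
  "J A B \<Psi> L = Re (J_complex A B \<Psi> L)"

lemma bounded_linear_ctransp: "bounded_linear (ctransp :: complex^'n^'m \<Rightarrow> complex^'m^'n)"
  by (rule linear_conv_bounded_linear[THEN iffD1], rule linearI)
     (simp_all add: ctransp_def vec_eq_iff)

lemma bounded_linear_Im_trace: "bounded_linear (\<lambda>M::complex^'n^'n. Im (trace M))"
  by (rule linear_conv_bounded_linear[THEN iffD1], rule linearI)
     (simp_all add: trace_def sum.distrib sum_distrib_left)

lemma circle_integral_fixed:
  fixes F :: "complex \<Rightarrow> 'a::euclidean_space"
  assumes T: "bounded_linear (T :: 'a \<Rightarrow> 'b::euclidean_space)"
    and S: "bounded_linear (S :: 'a \<Rightarrow> 'b)"
    and eq: "\<And>z. z \<in> unit_circle \<Longrightarrow> T (F z) = S (F z)"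
  shows "T (circle_integral F) = S (circle_integral F)"
proof -
  let ?f = "\<lambda>t. indicator {-pi..pi} t *\<^sub>R F (cis t)"
  interpret T: bounded_linear T by fact
  interpret S: bounded_linear S by fact
  have "T (integral\<^sup>L lebesgue ?f) = S (integral\<^sup>L lebesgue ?f)"
  proof (cases "integrable lebesgue ?f")
    case True
    have "T (integral\<^sup>L lebesgue ?f) = (\<integral>t. T (?f t) \<partial>lebesgue)"
      by (rule integral_bounded_linear[OF T True, symmetric])
    also have "\<dots> = (\<integral>t. S (?f t) \<partial>lebesgue)"
      by (rule Bochner_Integration.integral_cong) (simp_all add: T.scaleR S.scaleR eq)
    also have "\<dots> = S (integral\<^sup>L lebesgue ?f)"
      by (rule integral_bounded_linear[OF S True])
    finally show ?thesis .
  next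
    case False
    then show ?thesis
      by (simp add: not_integrable_integral_eq T.zero S.zero)
  qed
  then show ?thesis
    by (simp add: circle_integral_def set_lebesgue_integral_def T.scaleR S.scaleR)
qed

lemma hermitian_range_Gamma:
  assumes "L \<in> range_Gamma A B"
  shows "hermitian L"
proof -
  obtain \<Phi> where \<Phi>: "\<Phi> \<in> cont_hermitian" and L: "L = Gamma A B \<Phi>"
    using assms unfolding range_Gamma_def by blast
  have "ctransp L = id L"
    unfolding L Gamma_def
  proof (rule circle_integral_fixed[OF bounded_linear_ctransp])
    show "bounded_linear (id :: complex^'a^'a \<Rightarrow> complex^'a^'a)"
      by (simp add: id_def)
  next
    fix z :: complex assume "z \<in> unit_circle"
    then have "ctransp (\<Phi> z) = \<Phi> z"
      using \<Phi> unfolding cont_hermitian_def hermitian_def by blast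
    then show "ctransp (transfer A B z ** \<Phi> z ** ctransp (transfer A B z)) =
        id (transfer A B z ** \<Phi> z ** ctransp (transfer A B z))"
      by (simp add: ctransp_mult matrix_mul_assoc)
  qed
  then show ?thesis
    by (simp add: hermitian_def)
qed

lemma trace_hermitian_mult_real:
  fixes M N :: "complex^'n^'n"
  assumes "hermitian M" "hermitian N"
  shows "Im (trace (M ** N)) = 0"
proof -
  have "cnj (trace (M ** N)) = trace (ctransp (M ** N))"
    by (simp add: trace_def ctransp_def)
  also have "\<dots> = trace (M ** N)"
    using assms trace_mul_sym[of N M] by (simp add: ctransp_mult hermitian_def)
  finally show ?thesis
    using Reals_cnj_iff complex_is_Real_iff by blast
qed

lemma pos_def_inverse:
  fixes M :: "complex^'n^'n"
  assumes "pos_def M"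
  shows "invertible M" "hermitian (matrix_inv M)"
proof -
  have "x = 0" if "M *v x = 0" for x
    using assms that unfolding pos_def_def by (metis inner_zero_right less_irrefl)
  then show inv: "invertible M"
    by (metis invertible_left_inverse matrix_left_invertible_ker)
  have M: "ctransp M = M"
    using assms unfolding pos_def_def hermitian_def by blast
  have r: "M ** matrix_inv M = mat 1"
    using inv someI_ex[of "\<lambda>N. M ** N = mat 1 \<and> N ** M = mat 1"]
    unfolding invertible_def matrix_inv_def by blast
  then have l: "ctransp (matrix_inv M) ** M = mat 1"
    by (metis M ctransp_mult ctransp_mat_1)
  have "ctransp (matrix_inv M) = ctransp (matrix_inv M) ** (M ** matrix_inv M)"
    by (simp add: r)
  also have "\<dots> = matrix_inv M"
    by (simp only: matrix_mul_assoc l matrix_mul_lid)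
  finally show "hermitian (matrix_inv M)"
    by (simp add: hermitian_def)
qed

lemma J_complex_real:
  fixes A :: "complex^'n^'n" and B :: "complex^'m^'n"
  assumes "\<Psi> \<in> spectral_densities" "L \<in> L_Gamma A B"
  shows "Im (J_complex A B \<Psi> L) = 0"
proof -
  let ?F = "\<lambda>z. matrix_inv (Q_mat A B L z) ** \<Psi> z"
  have "hermitian L"
    using assms hermitian_range_Gamma unfolding L_Gamma_def by blast
  then have "Im (trace L) = 0"
    using trace_hermitian_mult_real[of L "mat 1"] by (simp add: hermitian_def)
  moreover have "Im (trace (circle_integral ?F)) = (\<lambda>_. 0) (circle_integral ?F)"
  proof (rule circle_integral_fixed[OF bounded_linear_Im_trace bounded_linear_zero])
    fix z :: complex assume "z \<in> unit_circle"
    then have "pos_def (Q_mat A B L z)" "hermitian (\<Psi> z)"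
      using assms unfolding L_Gamma_def spectral_densities_def pos_def_def by blast+
    then show "Im (trace (?F z)) = 0"
      by (simp add: trace_hermitian_mult_real pos_def_inverse)
  qed
  ultimately show ?thesis
    by (simp add: J_complex_def)
qed

end

theory Submission
  imports Defs
begin

text \<open>
  Restricting to the circle turns \<open>L \<mapsto> I + G\<^sup>* L G\<close> into an affine map \<open>Q_fun\<close> from the finite-dimensional
  space of matrices to the Banach algebra of bounded continuous matrix functions, equipped with the sup
  norm. On \<^term>\<open>L_Gamma A B\<close> its values are invertible in this algebra: the pointwise inverses are continuous
  on a compact set. So \<open>J\<close> is the sum of the linear term \<open>tr L\<close> and a bounded linear functional, the
  \<open>pairing\<close> with \<open>\<Psi>\<close>, applied to the inverse of an affine map. Inversion is smooth in every normed algebra,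
  as its derivatives are noncommutative polynomials in the inverse (\<open>Ck_on_polynomial_in\<close>), and smoothness
  of \<open>J\<close> follows without any differentiation under the integral sign.

  For strict convexity let \<open>X\<close>, \<open>Y\<close>, \<open>W\<close> be the inverses of \<open>P\<close>, \<open>Q\<close> and \<open>u P + v Q\<close>, with \<open>u + v = 1\<close>. Then
  \<open>u X + v Y - W = u (W - X) P (W - X) + v (W - Y) Q (W - Y)\<close> (\<open>inverse_convexity_gap\<close>), which is positive
  semidefinite and vanishes only for \<open>X = W = Y\<close>. The trace of a product of positive semidefinite matrices is
  nonnegative (\<open>trace_mult_nonneg\<close>), and \<open>\<Psi> \<ge> a I\<close>, so pairing the gap with \<open>\<Psi>\<close> gives at least \<open>a\<close>
  times the mean of its trace. This is positive unless \<open>G\<^sup>* (x - y) G\<close> vanishes on the circle, which for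
  \<open>x - y\<close> in the range of \<open>\<Gamma>\<close> forces \<open>x = y\<close> (\<open>range_Gamma_sandwich_eq_0\<close>).
\<close>

section \<open>Inversion in a normed algebra\<close>

lemma Ck_on_cong:
  assumes "Ck_on k V U f" "\<And>x. x \<in> U \<Longrightarrow> f x = g x"
  shows "Ck_on k V U g"
proof (cases k)
  case 0
  then show ?thesis
    using assms continuous_on_cong[of U U f g] by simp
next
  case (Suc j)
  with assms(1) obtain f' where
    f': "\<And>x. x \<in> U \<Longrightarrow> (f has_derivative f' x) (at x within U)"
      "\<And>v. v \<in> V \<Longrightarrow> Ck_on j V U (\<lambda>x. f' x v)" by auto
  have "(g has_derivative f' x) (at x within U)" if "x \<in> U" for x
    using has_derivative_transform[OF that, of g f] assms(2) f'(1)[OF that] by metis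
  then show ?thesis
    using f' unfolding Suc Ck_on.simps by blast
qed

locale unital_product = bounded_bilinear prod
  for prod :: "'b::real_normed_vector \<Rightarrow> 'b \<Rightarrow> 'b" (infixl "\<otimes>" 70) +
  fixes one :: 'b
  assumes assoc: "a \<otimes> b \<otimes> c = a \<otimes> (b \<otimes> c)"
    and one_left: "one \<otimes> a = a"
    and one_right: "a \<otimes> one = a"
begin

text \<open>Invertibility is only asserted on a set: off \<^term>\<open>L_Gamma A B\<close> the pointwise inverses need not form
  a bounded continuous function.\<close>

definition inverse_on :: "'a set \<Rightarrow> ('a \<Rightarrow> 'b) \<Rightarrow> ('a \<Rightarrow> 'b) \<Rightarrow> bool" where
  "inverse_on S Q R \<longleftrightarrow> (\<forall>x\<in>S. R x \<otimes> Q x = one \<and> Q x \<otimes> R x = one)"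

text \<open>The resolvent identity; continuity and differentiability of the inverse are both read off from it.\<close>

lemma inverse_diff:
  assumes "inverse_on S Q R" "x \<in> S" "y \<in> S"
  shows "R y - R x = - (R y \<otimes> (Q y - Q x) \<otimes> R x)"
proof -
  have "R y \<otimes> (Q y - Q x) \<otimes> R x = R y \<otimes> Q y \<otimes> R x - R y \<otimes> (Q x \<otimes> R x)"
    by (simp add: diff_left diff_right assoc)
  also have "\<dots> = R x - R y"
    using assms by (simp add: inverse_on_def one_left one_right)
  finally show ?thesis by simp
qed

text \<open>The resolvent identity bounds \<open>R y - R x\<close> by a multiple of \<open>norm (R y) * norm (Q y - Q x)\<close>. Once the second
  factor is small this forces \<open>norm (R y) \<le> 2 * norm (R x)\<close>, so that no bound on the inverses near
  \<open>x\<close> has to be assumed.\<close>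

lemma tendsto_inverse_on:
  fixes Q R :: "'a::topological_space \<Rightarrow> 'b"
  assumes inv: "inverse_on S Q R" and x: "x \<in> S"
    and Q: "(Q \<longlongrightarrow> Q x) (at x within S)"
  shows "(R \<longlongrightarrow> R x) (at x within S)"
proof -
  obtain K where K: "0 < K" "\<And>a b. norm (a \<otimes> b) \<le> norm a * norm b * K"
    using pos_bounded by blast
  define M where "M = K\<^sup>2 * norm (R x)"
  have M: "0 \<le> M"
    using K by (simp add: M_def)
  have bound: "norm (R y - R x) \<le> norm (R y) * (M * norm (Q y - Q x))" if "y \<in> S" for y
  proof -
    have "norm (R y - R x) = norm (R y \<otimes> (Q y - Q x) \<otimes> R x)"
      using inverse_diff[OF inv x that] by simp
    also have "\<dots> \<le> norm (R y \<otimes> (Q y - Q x)) * norm (R x) * K"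
      by (rule K)
    also have "\<dots> \<le> (norm (R y) * norm (Q y - Q x) * K) * norm (R x) * K"
      using K by (intro mult_right_mono) auto
    finally show ?thesis
      by (simp add: M_def power2_eq_square mult_ac)
  qed
  have Qd: "((\<lambda>y. M * norm (Q y - Q x)) \<longlongrightarrow> 0) (at x within S)"
    using tendsto_mult_left[OF tendsto_norm_zero[OF LIM_zero[OF Q]], of M] by simp
  then have "\<forall>\<^sub>F y in at x within S. M * norm (Q y - Q x) < 1/2"
    by (rule order_tendstoD) simp
  moreover have "\<forall>\<^sub>F y in at x within S. y \<in> S"
    by (auto simp: eventually_at_filter)
  ultimately have "\<forall>\<^sub>F y in at x within S.
      norm (R y - R x) \<le> 2 * norm (R x) * (M * norm (Q y - Q x))"
  proof eventually_elim
    case (elim y)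
    have "norm (R y - R x) \<le> norm (R y) * (1/2)"
      using bound[OF elim(2)] elim(1) by (smt (verit) mult_left_mono norm_ge_zero)
    then have "norm (R y) \<le> 2 * norm (R x)"
      using norm_triangle_ineq2[of "R y" "R x"] by simp
    then show ?case
      using bound[OF elim(2)] M by (smt (verit) mult_right_mono mult_nonneg_nonneg norm_ge_zero)
  qed
  moreover have "((\<lambda>y. 2 * norm (R x) * (M * norm (Q y - Q x))) \<longlongrightarrow> 0) (at x within S)"
    using tendsto_mult_left[OF Qd, of "2 * norm (R x)"] by simp
  ultimately have "((\<lambda>y. R y - R x) \<longlongrightarrow> 0) (at x within S)"
    by (rule Lim_null_comparison)
  then show ?thesis
    by (rule LIM_zero_cancel)
qed

lemma has_derivative_inverse_on:
  fixes Q R :: "'a::real_normed_vector \<Rightarrow> 'b"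
  assumes inv: "inverse_on S Q R" and x: "x \<in> S"
    and H: "bounded_linear H" and Q: "\<And>y. Q y = c + H y"
  shows "(R has_derivative (\<lambda>v. - (R x \<otimes> H v \<otimes> R x))) (at x within S)"
proof -
  interpret H: bounded_linear H by fact
  obtain K where K: "0 < K" "\<And>a b. norm (a \<otimes> b) \<le> norm a * norm b * K"
    using pos_bounded by blast
  obtain C where C: "0 < C" "\<And>v. norm (H v) \<le> norm v * C"
    using H.pos_bounded by blast
  define M where "M = K\<^sup>2 * C * norm (R x)"
  have "(H \<longlongrightarrow> H x) (at x within S)"
    by (rule H.tendsto[OF tendsto_ident_at])
  then have "(Q \<longlongrightarrow> Q x) (at x within S)"
    unfolding Q by (intro tendsto_intros)
  then have "(R \<longlongrightarrow> R x) (at x within S)"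
    by (rule tendsto_inverse_on[OF inv x])
  then have lim: "((\<lambda>y. M * norm (R y - R x)) \<longlongrightarrow> 0) (at x within S)"
    using tendsto_mult_left[OF tendsto_norm_zero[OF LIM_zero], of R "R x" "at x within S" M] by simp
  show ?thesis
  proof (rule has_derivativeI_sandwich[OF zero_less_one _ _ lim])
    show "bounded_linear (\<lambda>v. - (R x \<otimes> H v \<otimes> R x))"
      by (intro bounded_linear_minus bounded_linear_compose[OF bounded_linear_left]
          bounded_linear_compose[OF bounded_linear_right] H)
  next
    fix y assume y: "y \<in> S" "y \<noteq> x"
    have diff: "R y - R x = - (R y \<otimes> H (y - x) \<otimes> R x)"
      using inverse_diff[OF inv x y(1)] by (simp add: Q H.diff)
    have "(R y - R x) \<otimes> H (y - x) \<otimes> R x = R y \<otimes> H (y - x) \<otimes> R x - R x \<otimes> H (y - x) \<otimes> R x"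
      by (simp only: diff_left)
    then have "R y - R x - (- (R x \<otimes> H (y - x) \<otimes> R x)) = - ((R y - R x) \<otimes> H (y - x) \<otimes> R x)"
      unfolding diff by simp
    then have "norm (R y - R x - (- (R x \<otimes> H (y - x) \<otimes> R x))) =
        norm ((R y - R x) \<otimes> H (y - x) \<otimes> R x)"
      by simp
    also have "\<dots> \<le> norm ((R y - R x) \<otimes> H (y - x)) * norm (R x) * K"
      by (rule K)
    also have "\<dots> \<le> (norm (R y - R x) * norm (H (y - x)) * K) * norm (R x) * K"
      using K by (intro mult_right_mono) auto
    also have "\<dots> \<le> (norm (R y - R x) * (norm (y - x) * C) * K) * norm (R x) * K"
      using K C by (intro mult_right_mono mult_left_mono) auto
    also have "\<dots> = M * norm (R y - R x) * norm (y - x)"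
      by (simp add: M_def power2_eq_square mult_ac)
    finally show "norm (R y - R x - (- (R x \<otimes> H (y - x) \<otimes> R x))) / norm (y - x) \<le> M * norm (R y - R x)"
      using y by (simp add: divide_le_eq)
  qed
qed

text \<open>The derivative of \<open>R\<close> in a direction \<open>v\<close> is \<open>- R (H v) R\<close>, a noncommutative polynomial in \<open>R\<close> with
  constant coefficients. The class of all such polynomials is closed under directional derivatives,
  which is the invariant that carries the induction on the order of differentiability.\<close>

inductive polynomial_in :: "('a \<Rightarrow> 'b) \<Rightarrow> ('a \<Rightarrow> 'b) \<Rightarrow> bool" for R where
  const: "polynomial_in R (\<lambda>_. a)"
| self: "polynomial_in R R"
| minus: "polynomial_in R F \<Longrightarrow> polynomial_in R (\<lambda>x. - F x)"
| add: "polynomial_in R F \<Longrightarrow> polynomial_in R E \<Longrightarrow> polynomial_in R (\<lambda>x. F x + E x)"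
| mult: "polynomial_in R F \<Longrightarrow> polynomial_in R E \<Longrightarrow> polynomial_in R (\<lambda>x. F x \<otimes> E x)"

lemma polynomial_in_derivative:
  fixes Q R :: "'a::real_normed_vector \<Rightarrow> 'b"
  assumes "polynomial_in R F"
    and inv: "inverse_on S Q R" and H: "bounded_linear H" and Q: "\<And>y. Q y = c + H y"
  shows "\<exists>F'. (\<forall>x\<in>S. (F has_derivative F' x) (at x within S)) \<and>
              (\<forall>v. polynomial_in R (\<lambda>x. F' x v))"
  using assms(1)
proof induction
  case (const a)
  then show ?case
    by (intro exI[of _ "\<lambda>_ _. 0"]) (auto intro: polynomial_in.const)
next
  case self
  show ?case
    by (intro exI[of _ "\<lambda>x v. - (R x \<otimes> H v \<otimes> R x)"])
       (auto intro!: has_derivative_inverse_on[OF inv _ H Q] polynomial_in.intros)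
next
  case (minus F)
  then obtain F' where "\<forall>x\<in>S. (F has_derivative F' x) (at x within S)"
    "\<forall>v. polynomial_in R (\<lambda>x. F' x v)" by blast
  then show ?case
    by (intro exI[of _ "\<lambda>x v. - F' x v"]) (auto intro!: has_derivative_minus polynomial_in.minus)
next
  case (add F E)
  then obtain F' E' where "\<forall>x\<in>S. (F has_derivative F' x) (at x within S)"
    "\<forall>v. polynomial_in R (\<lambda>x. F' x v)" "\<forall>x\<in>S. (E has_derivative E' x) (at x within S)"
    "\<forall>v. polynomial_in R (\<lambda>x. E' x v)" by metis
  then show ?case
    by (intro exI[of _ "\<lambda>x v. F' x v + E' x v"])
       (auto intro!: has_derivative_add polynomial_in.add)
next
  case (mult F E)
  then obtain F' E' where "\<forall>x\<in>S. (F has_derivative F' x) (at x within S)"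
    "\<forall>v. polynomial_in R (\<lambda>x. F' x v)" "\<forall>x\<in>S. (E has_derivative E' x) (at x within S)"
    "\<forall>v. polynomial_in R (\<lambda>x. E' x v)" by metis
  then show ?case
    using mult.hyps
    by (intro exI[of _ "\<lambda>x v. F x \<otimes> E' x v + F' x v \<otimes> E x"])
       (auto intro!: FDERIV polynomial_in.add polynomial_in.mult)
qed

text \<open>The terms \<open>g\<close> and \<open>r\<close> are there for the induction: a derivative of \<open>T \<circ> F + g + r\<close> in a fixed direction
  is again of this form, with \<open>g\<close> having moved into the constant.\<close>

lemma Ck_on_polynomial_in:
  fixes Q R :: "'a::euclidean_space \<Rightarrow> 'b"
  assumes "polynomial_in R F" and T: "bounded_linear T" and "bounded_linear g"
    and inv: "inverse_on S Q R" and H: "bounded_linear H" and Q: "\<And>y. Q y = c + H y"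
  shows "Ck_on k V S (\<lambda>x. T (F x) + g x + r)"
  using assms(1,3)
proof (induction k arbitrary: F g r)
  case (0 F g r)
  then obtain F' where "\<forall>x\<in>S. (F has_derivative F' x) (at x within S)"
    using polynomial_in_derivative[OF _ inv H Q] by blast
  then have "continuous_on S F"
    by (meson has_derivative_continuous continuous_on_eq_continuous_within)
  then show ?case
    using 0 by (auto intro!: continuous_intros bounded_linear.continuous_on[OF T]
      bounded_linear.continuous_on[of g])
next
  case (Suc k F g r)
  then obtain F' where F': "\<forall>x\<in>S. (F has_derivative F' x) (at x within S)"
    and p: "\<forall>v. polynomial_in R (\<lambda>x. F' x v)"
    using polynomial_in_derivative[OF _ inv H Q] by blast
  have "((\<lambda>x. T (F x) + g x + r) has_derivative (\<lambda>v. T (F' x v) + g v)) (at x within S)"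
    if "x \<in> S" for x
    using F' that Suc.prems
    by (auto intro!: derivative_eq_intros bounded_linear.has_derivative[OF T]
        bounded_linear_imp_has_derivative)
  moreover have "Ck_on k V S (\<lambda>x. T (F' x v) + g v)" for v
    using Suc.IH[of "\<lambda>x. F' x v" "\<lambda>_. 0" "g v"] p by simp
  ultimately show ?case
    unfolding Ck_on.simps by (intro exI[of _ "\<lambda>x v. T (F' x v) + g v"]) blast
qed

text \<open>A quantitative form of the convexity of inversion. It is the variational characterisation of the
  inverse in disguise: \<open>Z \<otimes> M \<otimes> Z - 2 Z\<close> is minimal at \<open>Z = inverse M\<close>, where its value is minus that
  inverse, and both sides measure how far \<open>Z = W\<close> is from the minimisers for \<open>P\<close> and \<open>Q\<close>.\<close>

lemma inverse_convexity_gap: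
  assumes u: "u + v = (1::real)"
    and X: "X \<otimes> P = one" "P \<otimes> X = one" and Y: "Y \<otimes> Q = one" "Q \<otimes> Y = one"
    and W: "W \<otimes> (u *\<^sub>R P + v *\<^sub>R Q) = one"
  shows "u *\<^sub>R X + v *\<^sub>R Y - W =
    u *\<^sub>R ((W - X) \<otimes> P \<otimes> (W - X)) + v *\<^sub>R ((W - Y) \<otimes> Q \<otimes> (W - Y))"
proof -
  have square: "(W - Z) \<otimes> M \<otimes> (W - Z) = W \<otimes> M \<otimes> W - W - W + Z"
    if "Z \<otimes> M = one" "M \<otimes> Z = one" for Z M
  proof -
    have "(W - Z) \<otimes> M \<otimes> (W - Z) =
        W \<otimes> M \<otimes> W - W \<otimes> (M \<otimes> Z) - (Z \<otimes> M \<otimes> W - Z \<otimes> M \<otimes> Z)"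
      by (simp add: diff_left diff_right assoc)
    then show ?thesis
      by (simp only: that one_left one_right) simp
  qed
  have "u *\<^sub>R (W \<otimes> P \<otimes> W) + v *\<^sub>R (W \<otimes> Q \<otimes> W) = W \<otimes> (u *\<^sub>R P + v *\<^sub>R Q) \<otimes> W"
    by (simp only: add_left add_right scaleR_left scaleR_right)
  also have "\<dots> = W"
    by (simp only: W one_left)
  finally have 1: "u *\<^sub>R (W \<otimes> P \<otimes> W) + v *\<^sub>R (W \<otimes> Q \<otimes> W) = W" .
  have 2: "u *\<^sub>R W + v *\<^sub>R W = W"
    using u by (simp flip: scaleR_left_distrib)
  have "u *\<^sub>R ((W - X) \<otimes> P \<otimes> (W - X)) + v *\<^sub>R ((W - Y) \<otimes> Q \<otimes> (W - Y)) =
      (u *\<^sub>R (W \<otimes> P \<otimes> W) + v *\<^sub>R (W \<otimes> Q \<otimes> W)) - (u *\<^sub>R W + v *\<^sub>R W) - (u *\<^sub>R W + v *\<^sub>R W) + (u *\<^sub>R X + v *\<^sub>R Y)"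
    unfolding square[OF X] square[OF Y] scaleR_add_right scaleR_diff_right by simp
  then show ?thesis
    unfolding 1 2 by simp
qed

end

section \<open>Positive semidefinite complex matrices\<close>

lemma bounded_bilinear_matrix_mult:
  "bounded_bilinear ((**) :: complex^'k^'n \<Rightarrow> complex^'m^'k \<Rightarrow> complex^'m^'n)"
  unfolding bilinear_conv_bounded_bilinear[symmetric] bilinear_def
  by (intro conjI allI linearI)
     (simp_all add: matrix_matrix_mult_def vec_eq_iff sum.distrib algebra_simps scaleR_sum_right)

lemma bounded_bilinear_matrix_vector_mult:
  "bounded_bilinear ((*v) :: complex^'m^'n \<Rightarrow> complex^'m \<Rightarrow> complex^'n)"
  unfolding bilinear_conv_bounded_bilinear[symmetric] bilinear_def
  by (intro conjI allI linearI)
     (simp_all add: matrix_vector_mult_def vec_eq_iff sum.distrib algebra_simps scaleR_sum_right)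

global_interpretation mm: bounded_bilinear "(**) :: complex^'k^'n \<Rightarrow> complex^'m^'k \<Rightarrow> complex^'m^'n"
  by (rule bounded_bilinear_matrix_mult)

global_interpretation mv: bounded_bilinear "(*v) :: complex^'m^'n \<Rightarrow> complex^'m \<Rightarrow> complex^'n"
  by (rule bounded_bilinear_matrix_vector_mult)

global_interpretation mat_prod: unital_product "(**) :: complex^'n^'n \<Rightarrow> complex^'n^'n \<Rightarrow> complex^'n^'n" "mat 1"
  by (rule unital_product.intro[OF bounded_bilinear_matrix_mult], unfold_locales)
     (simp_all add: matrix_mul_assoc)

lemma bounded_linear_Re_trace: "bounded_linear (\<lambda>M::complex^'n^'n. Re (trace M))"
  by (rule linear_conv_bounded_linear[THEN iffD1], rule linearI)
     (simp_all add: trace_def sum.distrib sum_distrib_left)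

lemmas Re_trace_simps =
  linear_add[OF bounded_linear.linear[OF bounded_linear_Re_trace]]
  linear_diff[OF bounded_linear.linear[OF bounded_linear_Re_trace]]
  linear_scale[OF bounded_linear.linear[OF bounded_linear_Re_trace]]

lemmas ctransp_simps =
  linear_add[OF bounded_linear.linear[OF bounded_linear_ctransp]]
  linear_diff[OF bounded_linear.linear[OF bounded_linear_ctransp]]
  linear_scale[OF bounded_linear.linear[OF bounded_linear_ctransp]]

lemma inner_matrix_vector_mult:
  fixes M :: "complex^'m^'n"
  shows "x \<bullet> (M *v y) = (ctransp M *v x) \<bullet> y"
proof -
  have "(\<Sum>i\<in>UNIV. cnj (x $ i) * (\<Sum>j\<in>UNIV. M $ i $ j * y $ j)) =
      (\<Sum>j\<in>UNIV. cnj (\<Sum>i\<in>UNIV. cnj (M $ i $ j) * x $ i) * y $ j)"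
    by (simp add: sum_distrib_left sum_distrib_right mult_ac)
       (rule sum.swap)
  then show ?thesis
    by (simp add: inner_complex_vec matrix_vector_mult_def ctransp_def)
qed

lemma hermitian_nth: "hermitian M \<Longrightarrow> M $ j $ i = cnj (M $ i $ j)"
  by (metis (no_types, lifting) ctransp_def hermitian_def vec_lambda_beta)

lemma cmod_square: "(cmod z)\<^sup>2 = Re z * Re z + Im z * Im z"
  by (metis cmod_power2 power2_eq_square)

lemma Re_cnj_mult_self: "Re (cnj z * z) = (cmod z)\<^sup>2"
  by (simp add: cmod_square)

lemma matrix_vector_mult_axis:
  fixes M :: "complex^'m^'n"
  shows "(M *v axis k t) $ i = M $ i $ k * t"
  by (simp add: matrix_vector_mult_def axis_def if_distrib cong: if_cong)

text \<open>Completing the square in one coordinate, for the elimination step below.\<close>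

lemma hermitian_form_diff_axis:
  fixes P :: "complex^'n^'n"
  assumes "hermitian P"
  shows "(y - axis k t) \<bullet> (P *v (y - axis k t)) =
    y \<bullet> (P *v y) - 2 * Re (cnj t * (P *v y) $ k) + (cmod t)\<^sup>2 * Re (P $ k $ k)"
proof -
  have "Im (P $ k $ k) = 0"
    using arg_cong[OF hermitian_nth[OF assms, of k k], of Im] by simp
  then have "axis k t \<bullet> (P *v axis k t) = (cmod t)\<^sup>2 * Re (P $ k $ k)"
    by (simp add: inner_axis' matrix_vector_mult_axis inner_complex_def cmod_square algebra_simps)
  moreover have "axis k t \<bullet> (P *v y) = Re (cnj t * (P *v y) $ k)"
    by (simp add: inner_axis' inner_complex_def)
  moreover have "y \<bullet> (P *v axis k t) = axis k t \<bullet> (P *v y)"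
    using assms by (subst inner_matrix_vector_mult) (simp add: hermitian_def inner_commute)
  ultimately show ?thesis
    by (simp add: mv.diff_right inner_diff)
qed

definition outer :: "complex^'n \<Rightarrow> complex^'n^'n" where
  "outer x = (\<chi> i j. x $ i * cnj (x $ j))"

lemma hermitian_outer: "hermitian (outer x)"
  by (simp add: hermitian_def ctransp_def outer_def vec_eq_iff)

lemma outer_form: "y \<bullet> (outer x *v y) = (cmod (\<Sum>i\<in>UNIV. cnj (x $ i) * y $ i))\<^sup>2"
proof -
  let ?s = "\<Sum>i\<in>UNIV. cnj (x $ i) * y $ i"
  have "(outer x *v y) $ i = x $ i * ?s" for i
    by (simp add: outer_def matrix_vector_mult_def sum_distrib_left mult.assoc)
  then have "y \<bullet> (outer x *v y) = Re (\<Sum>i\<in>UNIV. cnj (y $ i) * (x $ i * ?s))"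
    by (simp only: inner_complex_vec)
  also have "(\<Sum>i\<in>UNIV. cnj (y $ i) * (x $ i * ?s)) = (\<Sum>i\<in>UNIV. cnj (y $ i) * x $ i) * ?s"
    by (simp only: sum_distrib_right mult.assoc)
  also have "(\<Sum>i\<in>UNIV. cnj (y $ i) * x $ i) = cnj ?s"
    by (simp add: mult.commute)
  also have "Re (cnj ?s * ?s) = (cmod ?s)\<^sup>2"
    by (simp only: Re_cnj_mult_self)
  finally show ?thesis .
qed

lemma trace_outer_mult: "Re (trace (outer x ** N)) = x \<bullet> (N *v x)"
proof -
  have "trace (outer x ** N) = (\<Sum>i\<in>UNIV. \<Sum>k\<in>UNIV. x $ i * cnj (x $ k) * N $ k $ i)"
    by (simp add: trace_def outer_def matrix_matrix_mult_def)
  also have "\<dots> = (\<Sum>k\<in>UNIV. \<Sum>i\<in>UNIV. x $ i * cnj (x $ k) * N $ k $ i)"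
    by (rule sum.swap)
  finally show ?thesis
    by (simp add: inner_complex_vec matrix_vector_mult_def sum_distrib_left mult_ac)
qed

lemma pos_semidef_row_zero:
  assumes P: "pos_semidef P" and k: "Re (P $ k $ k) = 0"
  shows "P $ k $ j = 0"
proof -
  define y :: "complex^'a" where "y = axis j 1"
  define q where "q = (P *v y) $ k"
  have herm: "hermitian P" and pos: "\<And>x. 0 \<le> x \<bullet> (P *v x)"
    using P unfolding pos_semidef_def by auto
  have ineq: "2 * s * (cmod q)\<^sup>2 \<le> y \<bullet> (P *v y)" for s :: real
  proof -
    have "0 \<le> y \<bullet> (P *v y) - 2 * Re (cnj (of_real s * q) * q)"
      using pos[of "y - axis k (of_real s * q)"] hermitian_form_diff_axis[OF herm, of y k "of_real s * q"] k
      unfolding q_def by simp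
    moreover have "Re (cnj (of_real s * q) * q) = s * (cmod q)\<^sup>2"
      by (simp add: cmod_square algebra_simps)
    ultimately show ?thesis by simp
  qed
  have "q = 0"
  proof (rule ccontr)
    assume "q \<noteq> 0"
    then have "2 * ((y \<bullet> (P *v y) + 1) / (cmod q)\<^sup>2) * (cmod q)\<^sup>2 = 2 * (y \<bullet> (P *v y) + 1)"
      by simp
    then show False
      using ineq[of "(y \<bullet> (P *v y) + 1) / (cmod q)\<^sup>2"] pos[of y] by simp
  qed
  then show ?thesis
    by (simp add: q_def y_def matrix_vector_mult_axis)
qed

text \<open>Cholesky elimination: subtracting from \<open>P\<close> the rank-one matrix of its column \<open>k\<close>, divided by the pivot,
  clears row and column \<open>k\<close>, keeps \<open>P\<close> positive semidefinite, and changes the trace by a value of the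
  quadratic form of \<open>N\<close>. The induction is on a set of indices outside of which the rows vanish; it
  replaces the use of a square root of \<open>P\<close>.\<close>

lemma trace_mult_nonneg:
  fixes P N :: "complex^'n^'n"
  assumes P: "pos_semidef P" and N: "pos_semidef N"
  shows "0 \<le> Re (trace (P ** N))"
proof -
  have "0 \<le> Re (trace (P ** N))"
    if "finite S" "pos_semidef P" "\<And>i j. i \<notin> S \<Longrightarrow> P $ i $ j = 0" for S and P :: "complex^'n^'n"
    using that
  proof (induction S arbitrary: P rule: finite_induct)
    case empty
    then have "P = 0"
      by (simp add: vec_eq_iff)
    then show ?case
      by (simp add: trace_def)
  next
    case (insert k S P)
    have herm: "hermitian P" and pos: "\<And>x. 0 \<le> x \<bullet> (P *v x)"
      using insert.prems unfolding pos_semidef_def by auto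
    define c where "c = Re (P $ k $ k)"
    have Pkk: "P $ k $ k = of_real c"
      using arg_cong[OF hermitian_nth[OF herm, of k k], of Im] by (simp add: c_def complex_eq_iff)
    have "0 \<le> c"
      using pos[of "axis k 1"]
      by (simp add: c_def inner_axis' matrix_vector_mult_axis inner_complex_def)
    show ?case
    proof (cases "c = 0")
      case True
      then have "P $ i $ j = 0" if "i \<notin> S" for i j
        using that insert.prems pos_semidef_row_zero[of P k j] unfolding c_def by (cases "i = k") auto
      then show ?thesis
        using insert by blast
    next
      case False
      with \<open>0 \<le> c\<close> have c: "0 < c" by simp
      define p where "p = column k P"
      define P' where "P' = P - (1 / c) *\<^sub>R outer p"
      have p_nth: "p $ i = P $ i $ k" for i
        by (simp add: p_def column_def)
      have pk: "(\<Sum>i\<in>UNIV. cnj (p $ i) * y $ i) = (P *v y) $ k" for y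
        by (simp add: p_nth matrix_vector_mult_def flip: hermitian_nth[OF herm])
      have "pos_semidef P'"
        unfolding pos_semidef_def
      proof (intro conjI allI)
        show "hermitian P'"
          using herm hermitian_outer[of p] by (simp add: P'_def hermitian_def ctransp_simps)
      next
        fix y
        define q where "q = (P *v y) $ k"
        have "y \<bullet> (P' *v y) = y \<bullet> (P *v y) - (1 / c) * (cmod q)\<^sup>2"
          by (simp add: P'_def mv.diff_left mv.scaleR_left inner_diff_right outer_form pk q_def)
        \<comment> \<open>\<open>q / c\<close> minimises \<open>t \<mapsto> (y - axis k t) \<bullet> (P *v (y - axis k t))\<close>, and the minimum is the
          quadratic form of the Schur complement.\<close>
        also have "\<dots> = y \<bullet> (P *v y) - 2 * ((1 / c) * (cmod q)\<^sup>2) + (cmod (q / of_real c))\<^sup>2 * c"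
          using c by (simp add: norm_divide power_divide power2_eq_square)
        also have "(1 / c) * (cmod q)\<^sup>2 = Re (cnj (q / of_real c) * q)"
          by (simp add: cmod_square add_divide_distrib)
        also have "y \<bullet> (P *v y) - 2 * Re (cnj (q / of_real c) * q) + (cmod (q / of_real c))\<^sup>2 * c =
            (y - axis k (q / of_real c)) \<bullet> (P *v (y - axis k (q / of_real c)))"
          unfolding q_def c_def by (rule hermitian_form_diff_axis[OF herm, symmetric])
        also have "0 \<le> \<dots>"
          by (rule pos)
        finally show "0 \<le> y \<bullet> (P' *v y)" .
      qed
      moreover have "P' $ i $ j = 0" if "i \<notin> S" for i j
      proof (cases "i = k")
        case True
        then show ?thesis
          using c hermitian_nth[OF herm, of j k]
          by (simp add: P'_def outer_def p_nth Pkk) (simp add: scaleR_conv_of_real)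
      next
        case False
        then show ?thesis
          using that insert.prems by (simp add: P'_def outer_def p_nth)
      qed
      ultimately have "0 \<le> Re (trace (P' ** N))"
        by (rule insert.IH)
      moreover have "0 \<le> (1 / c) * (p \<bullet> (N *v p))"
        using c N unfolding pos_semidef_def by simp
      moreover have "P = P' + (1 / c) *\<^sub>R outer p"
        by (simp add: P'_def)
      then have "Re (trace (P ** N)) = Re (trace (P' ** N)) + (1 / c) * (p \<bullet> (N *v p))"
        by (simp only: mm.add_left mm.scaleR_left Re_trace_simps trace_outer_mult real_scaleR_def)
      ultimately show ?thesis by linarith
    qed
  qed
  from this[of UNIV P] show ?thesis
    using P by simp
qed

lemma trace_ctransp_mult_self:
  fixes M :: "complex^'n^'m"
  shows "Re (trace (ctransp M ** M)) = (norm M)\<^sup>2"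
proof -
  have "Re (trace (ctransp M ** M)) = (\<Sum>i\<in>UNIV. \<Sum>j\<in>UNIV. M $ j $ i \<bullet> M $ j $ i)"
    by (simp add: trace_def ctransp_def matrix_matrix_mult_def inner_complex_def)
  also have "\<dots> = M \<bullet> M"
    by (subst sum.swap) (simp add: inner_vec_def)
  finally show ?thesis
    by (simp add: dot_square_norm)
qed

lemma trace_congruence:
  fixes N :: "complex^'m^'n" and Q :: "complex^'n^'n"
  shows "Re (trace (ctransp N ** Q ** N)) = (\<Sum>i\<in>UNIV. column i N \<bullet> (Q *v column i N))"
proof -
  have "(ctransp N ** Q ** N) $ i $ i = (\<Sum>j\<in>UNIV. cnj (column i N $ j) * (Q *v column i N) $ j)" for i
    unfolding matrix_mul_assoc[symmetric]
    by (simp add: matrix_matrix_mult_def ctransp_def column_def matrix_vector_mult_def)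
  then show ?thesis
    by (simp add: trace_def inner_complex_vec)
qed

lemma inner_congruence:
  fixes N :: "complex^'m^'n" and Q :: "complex^'n^'n"
  shows "x \<bullet> ((ctransp N ** Q ** N) *v x) = (N *v x) \<bullet> (Q *v (N *v x))"
  by (simp add: inner_matrix_vector_mult[of x] inner_matrix_vector_mult[of "N *v x"] ctransp_mult
      flip: matrix_vector_mul_assoc)

lemma hermitian_congruence: "hermitian Q \<Longrightarrow> hermitian (ctransp N ** Q ** N)"
  by (simp add: hermitian_def ctransp_mult matrix_mul_assoc)

lemma pos_def_imp_pos_semidef: "pos_def M \<Longrightarrow> pos_semidef M"
  unfolding pos_def_def pos_semidef_def by (metis inner_zero_left order.order_iff_strict)

lemma pos_semidef_congruence: "pos_semidef Q \<Longrightarrow> pos_semidef (ctransp N ** Q ** N)"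
  by (simp add: pos_semidef_def hermitian_congruence inner_congruence)

lemma trace_congruence_zero:
  fixes N :: "complex^'m^'n" and Q :: "complex^'n^'n"
  assumes Q: "pos_def Q" and 0: "Re (trace (ctransp N ** Q ** N)) = 0"
  shows "N = 0"
proof -
  have "\<forall>i\<in>UNIV. column i N \<bullet> (Q *v column i N) = 0"
    using 0 pos_def_imp_pos_semidef[OF Q] unfolding trace_congruence
    by (subst (asm) sum_nonneg_eq_0_iff) (auto simp: pos_semidef_def)
  then have "column i N = 0" for i
    using Q unfolding pos_def_def by (metis UNIV_I less_irrefl)
  then show ?thesis
    by (simp add: column_def vec_eq_iff)
qed

lemma trace_mult_lower_bound:
  fixes P M :: "complex^'n^'n"
  assumes "pos_semidef P" "loewner_le (a *\<^sub>R mat 1) M"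
  shows "a * Re (trace P) \<le> Re (trace (P ** M))"
  using trace_mult_nonneg[of P "M - a *\<^sub>R mat 1"] assms
  by (simp add: loewner_le_def mm.diff_right mm.scaleR_right Re_trace_simps)

text \<open>For \<open>0 \<le> M \<le> b I\<close>, both \<open>tr (M (b I - M))\<close> and \<open>tr (b I - M)\<close> are nonnegative, so
  \<open>tr (M M) \<le> b tr M \<le> b\<^sup>2 tr I\<close>.\<close>

lemma norm_bound_loewner:
  fixes M :: "complex^'n^'n"
  assumes M: "pos_semidef M" and b: "loewner_le M (b *\<^sub>R mat 1)" "0 \<le> b"
  shows "(norm M)\<^sup>2 \<le> b\<^sup>2 * CARD('n)"
proof -
  have I: "pos_semidef (mat 1 :: complex^'n^'n)"
    by (simp add: pos_semidef_def hermitian_def)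
  have "0 \<le> Re (trace (P ** (b *\<^sub>R mat 1 - M)))" if "pos_semidef P" for P
    using trace_mult_nonneg[OF that] b unfolding loewner_le_def by blast
  then have le: "Re (trace (P ** M)) \<le> b * Re (trace P)" if "pos_semidef P" for P
    using that by (simp add: mm.diff_right mm.scaleR_right Re_trace_simps)
  have "(norm M)\<^sup>2 = Re (trace (M ** M))"
    using M trace_ctransp_mult_self[of M] by (simp add: pos_semidef_def hermitian_def)
  also have "\<dots> \<le> b * Re (trace M)"
    by (rule le[OF M])
  also have "\<dots> \<le> b * (b * CARD('n))"
    using le[OF I] b by (intro mult_left_mono) (simp_all add: trace_I)
  finally show ?thesis
    by (simp add: power2_eq_square mult.assoc)
qed

lemma hermitian_add: "hermitian M \<Longrightarrow> hermitian N \<Longrightarrow> hermitian (u *\<^sub>R M + v *\<^sub>R N)"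
  by (simp add: hermitian_def ctransp_simps)

lemma pos_def_add:
  "pos_def M \<Longrightarrow> pos_def N \<Longrightarrow> 0 < u \<Longrightarrow> 0 < v \<Longrightarrow> pos_def (u *\<^sub>R M + v *\<^sub>R N)"
  by (auto simp: pos_def_def hermitian_add mv.add_left mv.scaleR_left inner_add_right
      intro!: add_pos_pos mult_pos_pos)

lemma pos_semidef_add:
  "pos_semidef M \<Longrightarrow> pos_semidef N \<Longrightarrow> 0 \<le> u \<Longrightarrow> 0 \<le> v \<Longrightarrow> pos_semidef (u *\<^sub>R M + v *\<^sub>R N)"
  by (simp add: pos_semidef_def hermitian_add mv.add_left mv.scaleR_left inner_add_right)

text \<open>The minimum of the form over \<open>S\<close> times the unit sphere is attained, hence positive.\<close>

lemma pos_def_uniform: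
  fixes M :: "'a::t2_space \<Rightarrow> complex^'m^'m"
  assumes S: "compact S" "continuous_on S M" and pos: "\<And>z. z \<in> S \<Longrightarrow> pos_def (M z)"
  obtains c where "0 < c" "\<And>z x. z \<in> S \<Longrightarrow> c * (norm x)\<^sup>2 \<le> x \<bullet> (M z *v x)"
proof (cases "S = {}")
  case False
  let ?K = "S \<times> sphere (0 :: complex^'m) 1"
  let ?q = "\<lambda>p. snd p \<bullet> (M (fst p) *v snd p)"
  have "norm (axis undefined 1 :: complex^'m) = 1"
    by (simp add: norm_axis_1)
  then have "?K \<noteq> {}"
    using False by (auto simp: ex_in_conv[symmetric])
  moreover have "compact ?K"
    using S by (intro compact_Times) auto
  moreover have "continuous_on ?K ?q"
    by (intro continuous_intros mv.continuous_on continuous_on_compose2[OF S(2)]) auto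
  ultimately obtain p where p: "p \<in> ?K" "\<And>p'. p' \<in> ?K \<Longrightarrow> ?q p \<le> ?q p'"
    using continuous_attains_inf[of ?K ?q] by blast
  have "snd p \<noteq> 0"
    using p(1) by auto
  then have "0 < ?q p"
    using p(1) pos[of "fst p"] by (auto simp: pos_def_def)
  moreover have "?q p * (norm x)\<^sup>2 \<le> x \<bullet> (M z *v x)" if "z \<in> S" for z x
  proof (cases "x = 0")
    case False
    define y where "y = (1 / norm x) *\<^sub>R x"
    have "norm y = 1"
      using False by (simp add: y_def)
    then have "?q p \<le> y \<bullet> (M z *v y)"
      using p(2)[of "(z, y)"] that by simp
    then have "?q p * (norm x)\<^sup>2 \<le> (y \<bullet> (M z *v y)) * (norm x)\<^sup>2"
      by (rule mult_right_mono) simp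
    also have "\<dots> = x \<bullet> (M z *v x)"
      using False by (simp add: y_def mv.scaleR_right power2_eq_square)
    finally show ?thesis .
  qed simp
  ultimately show thesis
    by (rule that)
qed (use that[of 1] in simp)

lemma matrix_inv_mult:
  fixes M :: "complex^'n^'n"
  assumes "invertible M"
  shows "matrix_inv M ** M = mat 1" "M ** matrix_inv M = mat 1"
  using someI_ex[OF assms[unfolded invertible_def]] by (simp_all add: matrix_inv_def)

lemma continuous_on_matrix_inv:
  fixes Q :: "'a::topological_space \<Rightarrow> complex^'n^'n"
  assumes Q: "continuous_on S Q" and inv: "\<And>x. x \<in> S \<Longrightarrow> invertible (Q x)"
  shows "continuous_on S (\<lambda>x. matrix_inv (Q x))"
proof -
  have "mat_prod.inverse_on S Q (\<lambda>x. matrix_inv (Q x))"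
    unfolding mat_prod.inverse_on_def using inv matrix_inv_mult by blast
  then show ?thesis
    using Q mat_prod.tendsto_inverse_on unfolding continuous_on_def by blast
qed

section \<open>Bounded continuous matrix functions and means over the circle\<close>

lemma norm_bcontfun_le:
  fixes f :: "'a::topological_space \<Rightarrow>\<^sub>C 'b::real_normed_vector"
  shows "norm (f t) \<le> norm f"
  using norm_bounded .

text \<open>Bounded continuous matrix functions form a Banach algebra under the pointwise product. Its
  sup norm turns uniformity on the circle into ordinary convergence, so that the calculus above
  applies to \<open>L \<mapsto> (t \<mapsto> Q_mat A B L (cis t))\<close> as a single affine map.\<close>

definition bcontfun_mult ::
  "('a::topological_space \<Rightarrow>\<^sub>C (complex^'n^'n)) \<Rightarrow> ('a \<Rightarrow>\<^sub>C (complex^'n^'n)) \<Rightarrow> ('a \<Rightarrow>\<^sub>C (complex^'n^'n))"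
  where "bcontfun_mult f g = Bcontfun (\<lambda>t. f t ** g t)"

lemma bcontfun_mult_apply:
  fixes f g :: "'a::topological_space \<Rightarrow>\<^sub>C (complex^'n^'n)"
  shows "bcontfun_mult f g t = f t ** g t"
proof -
  obtain K where K: "0 < K" "\<And>(M :: complex^'n^'n) (N :: complex^'n^'n). norm (M ** N) \<le> norm M * norm N * K"
    using mm.pos_bounded by blast
  have "norm (f t ** g t) \<le> norm f * norm g * K" for t
  proof -
    have "norm (f t ** g t) \<le> norm (f t) * norm (g t) * K" by (rule K)
    also have "\<dots> \<le> norm f * norm g * K"
      using K by (intro mult_right_mono mult_mono norm_bcontfun_le) auto
    finally show ?thesis .
  qed
  then have "(\<lambda>t. f t ** g t) \<in> bcontfun"
    by (intro bcontfun_normI mm.continuous_on) auto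
  then show ?thesis
    by (simp add: bcontfun_mult_def Bcontfun_inverse)
qed

lemma unital_product_bcontfun_mult:
  "unital_product
    (bcontfun_mult :: ('a::topological_space \<Rightarrow>\<^sub>C (complex^'n^'n)) \<Rightarrow> ('a \<Rightarrow>\<^sub>C (complex^'n^'n)) \<Rightarrow> _)
    (const_bcontfun (mat 1))"
proof
  obtain K where K: "0 < K" "\<And>(M :: complex^'n^'n) (N :: complex^'n^'n). norm (M ** N) \<le> norm M * norm N * K"
    using mm.pos_bounded by blast
  have "norm (bcontfun_mult f g) \<le> norm f * norm g * K" for f g :: "'a \<Rightarrow>\<^sub>C (complex^'n^'n)"
  proof (rule norm_bound)
    fix t
    have "norm (f t ** g t) \<le> norm (f t) * norm (g t) * K" by (rule K)
    also have "\<dots> \<le> norm f * norm g * K"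
      using K by (intro mult_right_mono mult_mono norm_bcontfun_le) auto
    finally show "norm (bcontfun_mult f g t) \<le> norm f * norm g * K"
      by (simp add: bcontfun_mult_apply)
  qed
  then show "\<exists>K. \<forall>f g :: 'a \<Rightarrow>\<^sub>C (complex^'n^'n). norm (bcontfun_mult f g) \<le> norm f * norm g * K"
    by blast
qed (auto intro!: bcontfun_eqI simp: bcontfun_mult_apply const_bcontfun.rep_eq mm.add_left
      mm.add_right mm.scaleR_left mm.scaleR_right matrix_mul_assoc)

global_interpretation bc: unital_product
  "bcontfun_mult :: ('a::topological_space \<Rightarrow>\<^sub>C (complex^'n^'n)) \<Rightarrow> ('a \<Rightarrow>\<^sub>C (complex^'n^'n)) \<Rightarrow> _"
  "const_bcontfun (mat 1)"
  by (rule unital_product_bcontfun_mult)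

lemma cis_image: "cis ` {-pi..pi} = unit_circle"
proof
  show "unit_circle \<subseteq> cis ` {-pi..pi}"
  proof
    fix z :: complex assume "z \<in> unit_circle"
    then have z: "norm z = 1"
      by simp
    then have "z = cis (Arg z)"
      using rcis_cmod_Arg[of z] by (simp add: rcis_def)
    then show "z \<in> cis ` {-pi..pi}"
      using Arg_bounded[of z] by (intro image_eqI[of z cis "Arg z"]) simp_all
  qed
qed auto

text \<open>The circle is parametrised by the whole line, because the type of bounded continuous functions
  has a type as its domain. The value is meaningful only for \<open>h\<close> continuous on the circle.\<close>

definition on_circle :: "(complex \<Rightarrow> 'b::real_normed_vector) \<Rightarrow> real \<Rightarrow>\<^sub>C 'b" where
  "on_circle h = Bcontfun (\<lambda>t. h (cis t))"

lemma on_circle_apply: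
  fixes h :: "complex \<Rightarrow> 'b::real_normed_vector"
  assumes h: "continuous_on unit_circle h"
  shows "on_circle h t = h (cis t)"
proof -
  have "compact (h ` unit_circle)"
    by (rule compact_continuous_image[OF h]) simp
  then have "bounded (h ` unit_circle)"
    by (rule compact_imp_bounded)
  then obtain b where b: "\<forall>z\<in>unit_circle. norm (h z) \<le> b"
    unfolding bounded_iff by blast
  have "continuous_on UNIV (\<lambda>t. h (cis t))"
    by (rule continuous_on_compose2[OF h]) (auto intro!: continuous_intros)
  then have "(\<lambda>t. h (cis t)) \<in> bcontfun"
    by (rule bcontfun_normI[where b = b]) (use b in simp)
  then show ?thesis
    by (simp add: on_circle_def Bcontfun_inverse)
qed

definition circle_mean :: "(real \<Rightarrow> 'a) \<Rightarrow> 'a::{banach, second_countable_topology}" where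
  "circle_mean f = (1 / (2 * pi)) *\<^sub>R set_lebesgue_integral lebesgue {-pi..pi} f"

lemma circle_integral_eq_mean: "circle_integral F = circle_mean (\<lambda>t. F (cis t))"
  by (simp add: circle_integral_def circle_mean_def)

lemma set_integrable_bounded_circle:
  fixes f :: "real \<Rightarrow> 'a::{banach, second_countable_topology}"
  assumes "f \<in> borel_measurable lebesgue" "\<And>t. norm (f t) \<le> C"
  shows "set_integrable lebesgue {-pi..pi} f"
  unfolding set_integrable_def
  by (rule integrableI_bounded_set_indicator[where B = C]) (use assms in auto)

lemma borel_measurable_bcontfun:
  fixes f :: "real \<Rightarrow>\<^sub>C 'a::real_normed_vector"
  shows "apply_bcontfun f \<in> borel_measurable lebesgue"
  by (intro measurable_completion) (simp add: borel_measurable_continuous_onI)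

lemma set_integrable_bcontfun:
  fixes f :: "real \<Rightarrow>\<^sub>C 'a::{banach, second_countable_topology}"
  shows "set_integrable lebesgue {-pi..pi} f"
  by (rule set_integrable_bounded_circle[OF borel_measurable_bcontfun norm_bcontfun_le])

lemma circle_mean_add:
  assumes "set_integrable lebesgue {-pi..pi} f" "set_integrable lebesgue {-pi..pi} g"
  shows "circle_mean (\<lambda>t. f t + g t) = circle_mean f + circle_mean g"
  using assms by (simp add: circle_mean_def set_integral_add scaleR_add_right)

lemma circle_mean_scaleR: "circle_mean (\<lambda>t. c *\<^sub>R f t) = c *\<^sub>R circle_mean f"
  by (simp add: circle_mean_def)

lemma circle_mean_bounded_linear:
  fixes f :: "real \<Rightarrow> 'a::{banach, second_countable_topology}"
    and T :: "'a \<Rightarrow> 'b::{banach, second_countable_topology}"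
  assumes T: "bounded_linear T" and f: "set_integrable lebesgue {-pi..pi} f"
  shows "T (circle_mean f) = circle_mean (\<lambda>t. T (f t))"
proof -
  interpret T: bounded_linear T by fact
  show ?thesis
    using integral_bounded_linear[OF T f[unfolded set_integrable_def]]
    by (simp add: circle_mean_def set_lebesgue_integral_def T.scaleR)
qed

lemma circle_mean_mono:
  fixes f g :: "real \<Rightarrow> real"
  assumes "set_integrable lebesgue {-pi..pi} f" "set_integrable lebesgue {-pi..pi} g"
    and "\<And>t. f t \<le> g t"
  shows "circle_mean f \<le> circle_mean g"
  unfolding circle_mean_def real_scaleR_def
  using assms by (intro mult_left_mono set_integral_mono) auto

lemma circle_mean_const: "circle_mean (\<lambda>t. c :: real) = c"
  by (simp add: circle_mean_def set_lebesgue_integral_def)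

lemma circle_mean_eq_0:
  fixes f :: "real \<Rightarrow> real"
  assumes int: "set_integrable lebesgue {-pi..pi} f" and cont: "continuous_on {-pi..pi} f"
    and nonneg: "\<And>t. 0 \<le> f t" and 0: "circle_mean f = 0" and t: "t \<in> {-pi..pi}"
  shows "f t = 0"
proof -
  have "integral {-pi..pi} f = 0"
    using 0 set_lebesgue_integral_eq_integral(2)[OF int] by (simp add: circle_mean_def)
  then show ?thesis
    using integral_eq_0_iff[OF cont] nonneg t by auto
qed

lemma spectral_density_bounded:
  assumes "\<Psi> \<in> spectral_densities"
  obtains C where "\<And>t. norm (\<Psi> (cis t)) \<le> C" "0 \<le> C"
proof -
  obtain a b where ab: "0 < a" "a \<le> b"
    and \<Psi>: "\<And>z. z \<in> unit_circle \<Longrightarrow> pos_def (\<Psi> z)"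
      "\<And>z. z \<in> unit_circle \<Longrightarrow> loewner_le (\<Psi> z) (b *\<^sub>R mat 1)"
    using assms unfolding spectral_densities_def by blast
  have "norm (\<Psi> (cis t)) \<le> sqrt (b\<^sup>2 * CARD('a))" for t
    by (rule real_le_rsqrt, rule norm_bound_loewner)
      (use \<Psi> ab in \<open>auto intro: pos_def_imp_pos_semidef\<close>)
  then show thesis
    by (rule that) simp
qed

text \<open>The density enters \<open>J\<close> only through this linear functional on matrix functions, which is bounded because
  \<open>\<Psi>\<close> is.\<close>

definition pairing :: "(complex \<Rightarrow> complex^'m^'m) \<Rightarrow> (real \<Rightarrow>\<^sub>C (complex^'m^'m)) \<Rightarrow> real" where
  "pairing \<Psi> F = circle_mean (\<lambda>t. Re (trace (F t ** \<Psi> (cis t))))"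

lemma set_integrable_density:
  fixes F :: "real \<Rightarrow>\<^sub>C (complex^'m^'m)"
  assumes "\<Psi> \<in> spectral_densities"
  shows "set_integrable lebesgue {-pi..pi} (\<lambda>t. F t ** \<Psi> (cis t))"
proof -
  obtain C where C: "\<And>t. norm (\<Psi> (cis t)) \<le> C" "0 \<le> C"
    using spectral_density_bounded[OF assms] by blast
  obtain K where K: "0 < K" "\<And>(M :: complex^'m^'m) (N :: complex^'m^'m). norm (M ** N) \<le> norm M * norm N * K"
    using mm.pos_bounded by blast
  have "(\<lambda>t. \<Psi> (cis t)) \<in> borel_measurable lebesgue"
    using assms by (simp add: spectral_densities_def)
  then have "(\<lambda>t. F t ** \<Psi> (cis t)) \<in> borel_measurable lebesgue"
    by (rule borel_measurable_continuous_Pair[OF borel_measurable_bcontfun, where H = "(**)"])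
       (intro mm.continuous_on continuous_intros)
  moreover have "norm (F t ** \<Psi> (cis t)) \<le> norm F * C * K" for t
  proof -
    have "norm (F t ** \<Psi> (cis t)) \<le> norm (F t) * norm (\<Psi> (cis t)) * K" by (rule K)
    also have "\<dots> \<le> norm F * C * K"
      using K C by (intro mult_right_mono mult_mono norm_bcontfun_le) auto
    finally show ?thesis .
  qed
  ultimately show ?thesis
    by (rule set_integrable_bounded_circle)
qed

lemma set_integrable_bounded_linear:
  fixes f :: "real \<Rightarrow> 'a::{banach, second_countable_topology}"
    and T :: "'a \<Rightarrow> 'b::{banach, second_countable_topology}"
  assumes T: "bounded_linear T" and f: "set_integrable M S f"
  shows "set_integrable M S (\<lambda>t. T (f t))"
  using integrable_bounded_linear[OF T f[unfolded set_integrable_def]]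
  by (simp add: set_integrable_def linear_scale[OF bounded_linear.linear[OF T]])

lemmas set_integrable_pairing =
  set_integrable_bounded_linear[OF bounded_linear_Re_trace set_integrable_density]

lemma bounded_linear_pairing:
  fixes \<Psi> :: "complex \<Rightarrow> complex^'m^'m"
  assumes \<Psi>: "\<Psi> \<in> spectral_densities"
  shows "bounded_linear (pairing \<Psi>)"
proof -
  obtain C where C: "\<And>t. norm (\<Psi> (cis t)) \<le> C" "0 \<le> C"
    using spectral_density_bounded[OF \<Psi>] by blast
  obtain K where K: "0 < K" "\<And>(M :: complex^'m^'m) (N :: complex^'m^'m). norm (M ** N) \<le> norm M * norm N * K"
    using mm.pos_bounded by blast
  obtain D where D: "0 < D" "\<And>M :: complex^'m^'m. norm (Re (trace M)) \<le> norm M * D"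
    using bounded_linear.pos_bounded[OF bounded_linear_Re_trace] by blast
  show ?thesis
  proof (rule bounded_linear_intro)
    show "pairing \<Psi> (F + E) = pairing \<Psi> F + pairing \<Psi> E" for F E
      unfolding pairing_def
      using circle_mean_add[OF set_integrable_pairing[OF \<Psi>, of F] set_integrable_pairing[OF \<Psi>, of E]]
      by (simp add: mm.add_left Re_trace_simps)
    show "pairing \<Psi> (r *\<^sub>R F) = r *\<^sub>R pairing \<Psi> F" for r F
      unfolding pairing_def circle_mean_scaleR[symmetric]
      by (simp add: mm.scaleR_left Re_trace_simps(3) del: real_scaleR_def)
    fix F :: "real \<Rightarrow>\<^sub>C (complex^'m^'m)"
    let ?c = "norm F * C * K * D"
    have "norm (Re (trace (F t ** \<Psi> (cis t)))) \<le> ?c" for t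
    proof -
      have "norm (Re (trace (F t ** \<Psi> (cis t)))) \<le> norm (F t ** \<Psi> (cis t)) * D" by (rule D)
      also have "\<dots> \<le> norm (F t) * norm (\<Psi> (cis t)) * K * D"
        using D by (intro mult_right_mono K) auto
      also have "\<dots> \<le> ?c"
        using K C D by (intro mult_right_mono mult_mono norm_bcontfun_le) auto
      finally show ?thesis .
    qed
    then have le: "Re (trace (F t ** \<Psi> (cis t))) \<le> ?c" and ge: "- ?c \<le> Re (trace (F t ** \<Psi> (cis t)))" for t
      unfolding real_norm_def abs_le_iff by (smt (verit))+
    have const: "set_integrable lebesgue {-pi..pi} (\<lambda>t. c :: real)" for c
      by (rule set_integrable_bounded_circle[of _ "norm c"]) auto
    have "pairing \<Psi> F \<le> ?c"
      using circle_mean_mono[OF set_integrable_pairing[OF \<Psi>] const le]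
      by (simp add: pairing_def circle_mean_const)
    moreover have "- ?c \<le> pairing \<Psi> F"
      using circle_mean_mono[OF const set_integrable_pairing[OF \<Psi>] ge]
      by (simp add: pairing_def circle_mean_const)
    ultimately show "norm (pairing \<Psi> F) \<le> norm F * (C * K * D)"
      by (simp add: abs_le_iff mult_ac)
  qed
qed

section \<open>The dual functional\<close>

locale stable_pair =
  fixes A :: "complex^'n^'n" and B :: "complex^'m^'n"
  assumes stable: "eigenvalue A l \<Longrightarrow> cmod l < 1"
begin

abbreviation "G \<equiv> transfer A B"

text \<open>A kernel vector would be an eigenvector for an eigenvalue of modulus one.\<close>

lemma invertible_resolvent:
  assumes "z \<in> unit_circle"
  shows "invertible (mat z - A)"
proof -
  have "x = 0" if "(mat z - A) *v x = 0" for x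
  proof (rule ccontr)
    assume "x \<noteq> 0"
    moreover have "mat z *v x = z *s x"
      by (simp add: mat_def matrix_vector_mult_def vec_eq_iff if_distrib[of "\<lambda>a. a * _"] cong: if_cong)
    then have "A *v x = z *s x"
      using that by (simp add: mv.diff_left)
    ultimately show False
      using stable[of z] assms by (auto simp: eigenvalue_def)
  qed
  then show ?thesis
    unfolding invertible_left_inverse matrix_left_invertible_ker by blast
qed

lemma continuous_on_transfer: "continuous_on unit_circle G"
proof -
  have "continuous_on unit_circle (\<lambda>z. mat z :: complex^'n^'n)"
    unfolding mat_def
  proof (intro continuous_on_vec_lambda)
    show "continuous_on unit_circle (\<lambda>z. if i = j then z else 0)" for i j :: 'n
      by (cases "i = j") auto
  qed
  then show ?thesis
    unfolding transfer_def[abs_def]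
    by (intro mm.continuous_on continuous_on_matrix_inv continuous_intros invertible_resolvent)
qed

lemma continuous_on_ctransp_transfer: "continuous_on unit_circle (\<lambda>z. ctransp (G z))"
  by (rule bounded_linear.continuous_on[OF bounded_linear_ctransp continuous_on_transfer])

definition sandwich :: "complex^'n^'n \<Rightarrow> real \<Rightarrow>\<^sub>C (complex^'m^'m)" where
  "sandwich L = on_circle (\<lambda>z. ctransp (G z) ** L ** G z)"

lemma sandwich_apply: "sandwich L t = ctransp (G (cis t)) ** L ** G (cis t)"
  unfolding sandwich_def
  by (rule on_circle_apply)
     (intro mm.continuous_on continuous_on_transfer continuous_on_ctransp_transfer continuous_intros)

lemma bounded_linear_sandwich: "bounded_linear sandwich"
  by (rule linear_conv_bounded_linear[THEN iffD1], rule linearI)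
     (auto intro!: bcontfun_eqI simp: sandwich_apply mm.add_left mm.add_right mm.scaleR_left mm.scaleR_right)

definition Q_fun :: "complex^'n^'n \<Rightarrow> real \<Rightarrow>\<^sub>C (complex^'m^'m)" where
  "Q_fun L = const_bcontfun (mat 1) + sandwich L"

lemma Q_fun_apply: "Q_fun L t = Q_mat A B L (cis t)"
  by (simp add: Q_fun_def sandwich_apply Q_mat_def const_bcontfun.rep_eq)

lemma continuous_on_Q_mat: "continuous_on unit_circle (Q_mat A B L)"
  unfolding Q_mat_def[abs_def]
  by (intro mm.continuous_on continuous_on_transfer continuous_on_ctransp_transfer continuous_intros)

definition R_fun :: "complex^'n^'n \<Rightarrow> real \<Rightarrow>\<^sub>C (complex^'m^'m)" where
  "R_fun L = on_circle (\<lambda>z. matrix_inv (Q_mat A B L z))"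

lemma pos_def_Q_mat: "L \<in> L_Gamma A B \<Longrightarrow> pos_def (Q_mat A B L (cis t))"
  by (simp add: L_Gamma_def)

lemma R_fun_apply:
  assumes "L \<in> L_Gamma A B"
  shows "R_fun L t = matrix_inv (Q_mat A B L (cis t))"
  unfolding R_fun_def
  by (rule on_circle_apply)
     (use assms in \<open>intro continuous_on_matrix_inv continuous_on_Q_mat pos_def_inverse(1);
        simp add: L_Gamma_def\<close>)

lemma inverse_on_Q_fun: "bc.inverse_on (L_Gamma A B) Q_fun R_fun"
  unfolding bc.inverse_on_def
  by (auto intro!: bcontfun_eqI simp: bcontfun_mult_apply Q_fun_apply R_fun_apply
      const_bcontfun.rep_eq matrix_inv_mult pos_def_inverse(1) pos_def_Q_mat)

lemma J_eq_pairing: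
  assumes \<Psi>: "\<Psi> \<in> spectral_densities" and L: "L \<in> L_Gamma A B"
  shows "J A B \<Psi> L = pairing \<Psi> (R_fun L) + Re (trace L)"
proof -
  have "circle_integral (\<lambda>z. matrix_inv (Q_mat A B L z) ** \<Psi> z) =
      circle_mean (\<lambda>t. R_fun L t ** \<Psi> (cis t))"
    by (simp add: circle_integral_eq_mean R_fun_apply[OF L])
  then show ?thesis
    using circle_mean_bounded_linear[OF bounded_linear_Re_trace set_integrable_density[OF \<Psi>, of "R_fun L"]]
    by (simp add: J_def J_complex_def pairing_def)
qed

lemma Ck_on_J:
  assumes \<Psi>: "\<Psi> \<in> spectral_densities"
  shows "Ck_on k V (L_Gamma A B) (J A B \<Psi>)"
proof -
  have "Ck_on k V (L_Gamma A B) (\<lambda>L. pairing \<Psi> (R_fun L) + Re (trace L) + 0)"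
    by (rule bc.Ck_on_polynomial_in[OF bc.polynomial_in.self bounded_linear_pairing[OF \<Psi>]
        bounded_linear_Re_trace inverse_on_Q_fun bounded_linear_sandwich Q_fun_def])
  then show ?thesis
    by (rule Ck_on_cong) (simp add: J_eq_pairing[OF \<Psi>])
qed

lemma set_integrable_Gamma:
  assumes "continuous_on unit_circle \<Phi>"
  shows "set_integrable lebesgue {-pi..pi} (\<lambda>t. G (cis t) ** \<Phi> (cis t) ** ctransp (G (cis t)))"
proof -
  have "continuous_on unit_circle (\<lambda>z. G z ** \<Phi> z ** ctransp (G z))"
    by (intro mm.continuous_on continuous_on_transfer continuous_on_ctransp_transfer assms)
  from on_circle_apply[OF this] set_integrable_bcontfun show ?thesis
    by (metis (no_types, lifting) set_integrable_cong)
qed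

lemma subspace_range_Gamma: "subspace (range_Gamma A B)"
proof -
  have "Gamma A B (\<lambda>_. 0) = 0"
    by (simp add: Gamma_def circle_integral_def)
  moreover have "(\<lambda>_. 0) \<in> (cont_hermitian :: (complex \<Rightarrow> complex^'m^'m) set)"
    by (simp add: cont_hermitian_def hermitian_def ctransp_def vec_eq_iff)
  ultimately have 0: "0 \<in> range_Gamma A B"
    unfolding range_Gamma_def by (metis image_eqI)
  have add: "L + M \<in> range_Gamma A B" if LM: "L \<in> range_Gamma A B" "M \<in> range_Gamma A B" for L M
  proof -
    obtain \<Phi> \<Theta> where \<Phi>: "\<Phi> \<in> cont_hermitian" "L = Gamma A B \<Phi>"
      and \<Theta>: "\<Theta> \<in> cont_hermitian" "M = Gamma A B \<Theta>"
      using LM unfolding range_Gamma_def by blast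
    have "(\<lambda>z. \<Phi> z + \<Theta> z) \<in> cont_hermitian"
      using \<Phi>(1) \<Theta>(1) by (auto simp: cont_hermitian_def hermitian_def ctransp_def vec_eq_iff
          intro!: continuous_intros)
    moreover have "L + M = Gamma A B (\<lambda>z. \<Phi> z + \<Theta> z)"
      using circle_mean_add[OF set_integrable_Gamma set_integrable_Gamma, of \<Phi> \<Theta>] \<Phi> \<Theta>
      by (simp add: Gamma_def circle_integral_eq_mean cont_hermitian_def mm.add_left mm.add_right)
    ultimately show ?thesis
      unfolding range_Gamma_def by blast
  qed
  have scale: "c *\<^sub>R L \<in> range_Gamma A B" if L: "L \<in> range_Gamma A B" for L c
  proof -
    obtain \<Phi> where \<Phi>: "\<Phi> \<in> cont_hermitian" "L = Gamma A B \<Phi>"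
      using L unfolding range_Gamma_def by blast
    have "(\<lambda>z. c *\<^sub>R \<Phi> z) \<in> cont_hermitian"
      using \<Phi>(1) by (auto simp: cont_hermitian_def hermitian_def ctransp_def vec_eq_iff
          intro!: continuous_intros)
    moreover have "c *\<^sub>R L = Gamma A B (\<lambda>z. c *\<^sub>R \<Phi> z)"
      by (simp add: \<Phi> Gamma_def circle_integral_eq_mean mm.scaleR_left mm.scaleR_right circle_mean_scaleR)
    ultimately show ?thesis
      unfolding range_Gamma_def by blast
  qed
  show ?thesis
    using 0 add scale by (rule subspaceI)
qed

text \<open>\<^term>\<open>Gamma A B\<close> is the adjoint of \<open>L \<mapsto> G\<^sup>* L G\<close>, and the range of an adjoint meets the kernel only in \<open>0\<close>:
  if \<open>L = Gamma A B \<Phi>\<close>, then \<open>tr (L L)\<close> is the mean of \<open>tr (G\<^sup>* L G \<Phi>)\<close>. This is why \<open>J\<close> is strictly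
  convex on the range, although it need not be on all Hermitian matrices.\<close>

lemma range_Gamma_sandwich_eq_0:
  assumes L: "L \<in> range_Gamma A B" and 0: "sandwich L = 0"
  shows "L = 0"
proof -
  obtain \<Phi> where \<Phi>: "\<Phi> \<in> cont_hermitian" "L = Gamma A B \<Phi>"
    using L unfolding range_Gamma_def by blast
  let ?F = "\<lambda>t. G (cis t) ** \<Phi> (cis t) ** ctransp (G (cis t))"
  have int: "set_integrable lebesgue {-pi..pi} ?F"
    using \<Phi> by (intro set_integrable_Gamma) (simp add: cont_hermitian_def)
  have "bounded_linear (\<lambda>M. Re (trace (L ** M)))"
    by (rule bounded_linear_compose[OF bounded_linear_Re_trace mm.bounded_linear_right])
  from circle_mean_bounded_linear[OF this int]
  have "Re (trace (L ** L)) = circle_mean (\<lambda>t. Re (trace (L ** ?F t)))"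
    by (simp add: \<Phi>(2) Gamma_def circle_integral_eq_mean)
  moreover have "trace (L ** ?F t) = 0" for t
  proof -
    have "trace (L ** ?F t) = trace (ctransp (G (cis t)) ** (L ** G (cis t) ** \<Phi> (cis t)))"
      by (subst trace_mul_sym) (simp add: matrix_mul_assoc)
    also have "\<dots> = trace (sandwich L t ** \<Phi> (cis t))"
      by (simp add: sandwich_apply matrix_mul_assoc)
    finally show ?thesis
      by (simp add: 0 trace_def matrix_matrix_mult_def)
  qed
  ultimately have "Re (trace (L ** L)) = 0"
    by (simp add: circle_mean_const)
  then show ?thesis
    using trace_ctransp_mult_self[of L] hermitian_range_Gamma[OF L] by (simp add: hermitian_def)
qed

lemma hermitian_Q_mat:
  assumes "L \<in> range_Gamma A B"
  shows "hermitian (Q_mat A B L z)"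
  using hermitian_congruence[OF hermitian_range_Gamma[OF assms], of "G z"]
  by (simp add: Q_mat_def hermitian_def ctransp_def vec_eq_iff mat_def)

text \<open>By compactness of the circle the forms of \<open>Q_mat A B L z\<close> have a common lower bound \<open>c > 0\<close>, which a
  perturbation of \<open>L\<close> of size less than \<open>e = c / (C K)\<close> cannot exhaust.\<close>

lemma openin_L_Gamma: "openin (top_of_set (range_Gamma A B)) (L_Gamma A B)"
  unfolding openin_euclidean_subtopology_iff
proof (intro conjI ballI)
  show "L_Gamma A B \<subseteq> range_Gamma A B"
    by (auto simp: L_Gamma_def)
next
  fix L assume L: "L \<in> L_Gamma A B"
  obtain c where c: "0 < c"
      "\<And>z x. z \<in> unit_circle \<Longrightarrow> c * (norm x)\<^sup>2 \<le> x \<bullet> (Q_mat A B L z *v x)"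
    by (rule pos_def_uniform[OF compact_sphere continuous_on_Q_mat[of L]])
       (use L in \<open>auto simp: L_Gamma_def\<close>)
  obtain K where K: "0 < K"
      "\<And>(M :: complex^'m^'m) (x :: complex^'m). norm (M *v x) \<le> norm M * norm x * K"
    using mv.pos_bounded by blast
  obtain C where C: "0 < C" "\<And>M. norm (sandwich M) \<le> norm M * C"
    using bounded_linear.pos_bounded[OF bounded_linear_sandwich] by blast
  define e where "e = c / (C * K)"
  have "0 < e"
    using c K C by (simp add: e_def)
  moreover have "L' \<in> L_Gamma A B" if L': "L' \<in> range_Gamma A B" "dist L' L < e" for L'
    unfolding L_Gamma_def
  proof (intro CollectI conjI ballI)
    fix z :: complex assume z: "z \<in> unit_circle"
    then obtain t where t: "z = cis t"
      using cis_image by blast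
    have "0 < x \<bullet> (Q_mat A B L' z *v x)" if "x \<noteq> 0" for x
    proof -
      let ?S = "sandwich (L' - L) t"
      have "Q_mat A B L' z = Q_mat A B L z + ?S"
        by (simp add: Q_mat_def t sandwich_apply mm.diff_left mm.diff_right)
      then have eq: "x \<bullet> (Q_mat A B L' z *v x) = x \<bullet> (Q_mat A B L z *v x) + x \<bullet> (?S *v x)"
        by (simp add: mv.add_left inner_add_right)
      have "\<bar>x \<bullet> (?S *v x)\<bar> \<le> norm x * norm (?S *v x)"
        by (rule Cauchy_Schwarz_ineq2)
      also have "\<dots> \<le> norm x * (norm ?S * norm x * K)"
        by (intro mult_left_mono K) auto
      also have "norm ?S \<le> norm (L' - L) * C"
        using norm_bcontfun_le C(2) by (rule order_trans)
      also have "norm x * (norm (L' - L) * C * norm x * K) = (norm (L' - L) * (C * K)) * (norm x)\<^sup>2"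
        by (simp add: power2_eq_square mult_ac)
      also have "\<dots> < c * (norm x)\<^sup>2"
        using L'(2) C K that by (intro mult_strict_right_mono) (auto simp: e_def dist_norm field_simps)
      finally show ?thesis
        using c(2)[OF z, of x] K(1) unfolding eq by (auto simp: mult_left_mono mult_right_mono)
    qed
    then show "pos_def (Q_mat A B L' z)"
      using hermitian_Q_mat[OF L'(1)] by (simp add: pos_def_def)
  qed (rule L')
  ultimately show "\<exists>e>0. \<forall>L'\<in>range_Gamma A B. dist L' L < e \<longrightarrow> L' \<in> L_Gamma A B"
    by blast
qed

lemma Q_mat_convex_combination:
  assumes "u + v = 1"
  shows "Q_mat A B (u *\<^sub>R x + v *\<^sub>R y) z = u *\<^sub>R Q_mat A B x z + v *\<^sub>R Q_mat A B y z"
proof -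
  have "u *\<^sub>R mat 1 + v *\<^sub>R mat 1 = (mat 1 :: complex^'m^'m)"
    using assms by (simp flip: scaleR_left_distrib)
  then show ?thesis
    by (simp add: Q_mat_def mm.add_left mm.add_right mm.scaleR_left mm.scaleR_right scaleR_add_right
        add.assoc add.left_commute)
qed

lemma L_Gamma_convex_combination:
  assumes "x \<in> L_Gamma A B" "y \<in> L_Gamma A B" "0 < u" "0 < v" "u + v = 1"
  shows "u *\<^sub>R x + v *\<^sub>R y \<in> L_Gamma A B"
  using assms subspace_range_Gamma
  by (auto simp: L_Gamma_def Q_mat_convex_combination intro!: pos_def_add subspace_add subspace_scale)

lemma convex_L_Gamma: "convex (L_Gamma A B)"
proof (rule convexI)
  fix x y :: "complex^'n^'n" and u v :: real
  assume xy: "x \<in> L_Gamma A B" "y \<in> L_Gamma A B" and uv: "0 \<le> u" "0 \<le> v" "u + v = 1"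
  show "u *\<^sub>R x + v *\<^sub>R y \<in> L_Gamma A B"
    using xy uv L_Gamma_convex_combination[OF xy _ _ uv(3)] by (cases "u = 0"; cases "v = 0") auto
qed

lemma hermitian_R_fun: "L \<in> L_Gamma A B \<Longrightarrow> hermitian (R_fun L t)"
  by (simp add: R_fun_apply pos_def_inverse(2) pos_def_Q_mat)

text \<open>The convexity gap of \<open>J\<close> is the mean of \<open>tr (D \<Psi>)\<close>, where the gap \<open>D\<close> of the inverses is positive
  semidefinite by \<open>inverse_convexity_gap\<close>. Coercivity of \<open>\<Psi>\<close> bounds it below by a multiple of the mean
  of \<open>tr D\<close>. Unlike \<open>tr (D \<Psi>)\<close>, the function \<open>tr D\<close> is continuous, so if its mean vanishes, it vanishes
  everywhere; then \<open>x\<close> and \<open>y\<close> have the same inverses on the whole circle.\<close>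

lemma J_strict_inequality:
  assumes \<Psi>: "\<Psi> \<in> spectral_densities"
    and x: "x \<in> L_Gamma A B" and y: "y \<in> L_Gamma A B" and uv: "0 < u" "0 < v" "u + v = 1"
    and "x \<noteq> y"
  shows "J A B \<Psi> (u *\<^sub>R x + v *\<^sub>R y) < u * J A B \<Psi> x + v * J A B \<Psi> y"
proof -
  define w where "w = u *\<^sub>R x + v *\<^sub>R y"
  have w: "w \<in> L_Gamma A B"
    unfolding w_def by (rule L_Gamma_convex_combination[OF x y uv])
  have Qw: "Q_fun w = u *\<^sub>R Q_fun x + v *\<^sub>R Q_fun y"
    by (rule bcontfun_eqI) (simp add: Q_fun_apply w_def Q_mat_convex_combination[OF uv(3)])
  define D where "D = u *\<^sub>R R_fun x + v *\<^sub>R R_fun y - R_fun w"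
  have "D = u *\<^sub>R bcontfun_mult (bcontfun_mult (R_fun w - R_fun x) (Q_fun x)) (R_fun w - R_fun x) +
      v *\<^sub>R bcontfun_mult (bcontfun_mult (R_fun w - R_fun y) (Q_fun y)) (R_fun w - R_fun y)"
    unfolding D_def
    by (rule bc.inverse_convexity_gap[OF uv(3)])
       (use inverse_on_Q_fun x y w in \<open>auto simp: bc.inverse_on_def simp flip: Qw\<close>)
  then have D: "D t = u *\<^sub>R (ctransp (R_fun w t - R_fun x t) ** Q_mat A B x (cis t) ** (R_fun w t - R_fun x t)) +
      v *\<^sub>R (ctransp (R_fun w t - R_fun y t) ** Q_mat A B y (cis t) ** (R_fun w t - R_fun y t))" for t
    using hermitian_R_fun[OF x, of t] hermitian_R_fun[OF y, of t] hermitian_R_fun[OF w, of t]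
    by (simp add: bcontfun_mult_apply Q_fun_apply ctransp_simps hermitian_def)
  let ?p = "\<lambda>t. ctransp (R_fun w t - R_fun x t) ** Q_mat A B x (cis t) ** (R_fun w t - R_fun x t)"
  let ?q = "\<lambda>t. ctransp (R_fun w t - R_fun y t) ** Q_mat A B y (cis t) ** (R_fun w t - R_fun y t)"
  have psd: "pos_semidef (?p t)" "pos_semidef (?q t)" for t
    by (rule pos_semidef_congruence[OF pos_def_imp_pos_semidef[OF pos_def_Q_mat[OF x]]])
       (rule pos_semidef_congruence[OF pos_def_imp_pos_semidef[OF pos_def_Q_mat[OF y]]])
  obtain a where a: "0 < a" "\<And>z. z \<in> unit_circle \<Longrightarrow> loewner_le (a *\<^sub>R mat 1) (\<Psi> z)"
    using \<Psi> unfolding spectral_densities_def by blast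
  have psdD: "pos_semidef (D t)" for t
    unfolding D using uv by (intro pos_semidef_add psd) simp_all
  let ?d = "\<lambda>t. Re (trace (D t))"
  have d_int: "set_integrable lebesgue {-pi..pi} ?d"
    by (rule set_integrable_bounded_linear[OF bounded_linear_Re_trace set_integrable_bcontfun])
  have I: "pos_semidef (mat 1 :: complex^'m^'m)"
    by (simp add: pos_semidef_def hermitian_def)
  have d_nonneg: "0 \<le> ?d t" for t
    using trace_mult_nonneg[OF psdD I] by simp
  have "circle_mean ?d \<noteq> 0"
  proof
    assume 0: "circle_mean ?d = 0"
    have "continuous_on {-pi..pi} ?d"
      by (intro bounded_linear.continuous_on[OF bounded_linear_Re_trace]) simp
    note d0 = circle_mean_eq_0[OF d_int this d_nonneg 0]
    have "sandwich (x - y) t = 0" if t: "t \<in> {-pi..pi}" for t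
    proof -
      have "u * Re (trace (?p t)) + v * Re (trace (?q t)) = 0"
        using d0[OF t] unfolding D Re_trace_simps by simp
      moreover have "0 \<le> Re (trace (?p t))" "0 \<le> Re (trace (?q t))"
        using trace_mult_nonneg[OF psd(1) I, of t] trace_mult_nonneg[OF psd(2) I, of t] by simp_all
      ultimately have "Re (trace (?p t)) = 0" "Re (trace (?q t)) = 0"
        using uv by (smt (verit) mult_nonneg_nonneg mult_pos_pos)+
      then have "R_fun w t - R_fun x t = 0" "R_fun w t - R_fun y t = 0"
        using trace_congruence_zero pos_def_Q_mat x y by blast+
      then have "matrix_inv (Q_mat A B x (cis t)) = matrix_inv (Q_mat A B y (cis t))"
        by (simp add: R_fun_apply x y)
      then have "Q_mat A B x (cis t) = Q_mat A B y (cis t)"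
        using matrix_inv_mult[OF pos_def_inverse(1)[OF pos_def_Q_mat[OF x]]]
          matrix_inv_mult[OF pos_def_inverse(1)[OF pos_def_Q_mat[OF y]]]
        by (metis matrix_mul_assoc matrix_mul_lid matrix_mul_rid)
      then show ?thesis
        by (simp add: Q_mat_def sandwich_apply mm.diff_left mm.diff_right)
    qed
    then have "sandwich (x - y) t = 0" for t
    proof -
      obtain s where "s \<in> {-pi..pi}" "cis t = cis s"
        using cis_image by (metis (no_types, lifting) imageE mem_sphere_0 norm_cis)
      with \<open>\<And>t. t \<in> {-pi..pi} \<Longrightarrow> sandwich (x - y) t = 0\<close>[of s] show ?thesis
        by (simp add: sandwich_apply)
    qed
    then have "sandwich (x - y) = 0"
      by (intro bcontfun_eqI) simp
    moreover have "x - y \<in> range_Gamma A B"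
      using x y subspace_range_Gamma by (auto simp: L_Gamma_def intro: subspace_diff)
    ultimately show False
      using range_Gamma_sandwich_eq_0 \<open>x \<noteq> y\<close> by fastforce
  qed
  moreover have "0 \<le> circle_mean ?d"
    using circle_mean_mono[OF set_integrable_bcontfun[of 0] d_int] d_nonneg circle_mean_const[of 0] by simp
  ultimately have "0 < a * circle_mean ?d"
    using a by simp
  also have "\<dots> = circle_mean (\<lambda>t. a *\<^sub>R ?d t)"
    using circle_mean_scaleR[of a ?d] by simp
  also have "\<dots> \<le> pairing \<Psi> D"
    unfolding pairing_def
    by (rule circle_mean_mono[OF set_integrable_scaleR_right[OF d_int] set_integrable_pairing[OF \<Psi>]])
       (simp add: trace_mult_lower_bound[OF psdD] a)
  also have "\<dots> = u * pairing \<Psi> (R_fun x) + v * pairing \<Psi> (R_fun y) - pairing \<Psi> (R_fun w)"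
    using bounded_linear.linear[OF bounded_linear_pairing[OF \<Psi>]]
    by (simp add: D_def linear_diff linear_add linear_scale)
  finally have "pairing \<Psi> (R_fun w) < u * pairing \<Psi> (R_fun x) + v * pairing \<Psi> (R_fun y)"
    by simp
  moreover have "Re (trace w) = u * Re (trace x) + v * Re (trace y)"
    by (simp add: w_def Re_trace_simps)
  ultimately show ?thesis
    by (simp add: J_eq_pairing[OF \<Psi>] x y w flip: w_def) (simp add: algebra_simps)
qed

end

theorem theoremV3:
  fixes A :: "complex^'n^'n" and B :: "complex^'m^'n"
    and \<Psi> :: "complex \<Rightarrow> complex^'m^'m"
  assumes stable: "\<And>l. eigenvalue A l \<Longrightarrow> cmod l < 1"
    and full_column_rank: "rank B = CARD('m)"
    and reach: "reachable A B"
    and feasible: "\<exists>H :: complex^'n^'m. mat 1 - A ** ctransp A = B ** H + ctransp H ** ctransp B"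
    and density: "\<Psi> \<in> spectral_densities"
  shows "smooth_in (range_Gamma A B) (L_Gamma A B) (J A B \<Psi>) \<and>
         strictly_convex_on (L_Gamma A B) (J A B \<Psi>)"
proof -
  interpret stable_pair A B
    by unfold_locales (rule stable)
  show ?thesis
    unfolding smooth_in_def strictly_convex_on_def
    using subspace_range_Gamma openin_L_Gamma Ck_on_J[OF density] convex_L_Gamma
      J_strict_inequality[OF density] by blast
qed

end
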